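(* Let $K$ be a field and let $A$ be a finitely generated $K$-algebra that is a domain with $\mathrm{GKdim}(A)<3$, and let $Q(A)$ be its quotient division algebra. If $D$ is a division $K$-subalgebra of $Q(A)$ with $\mathrm{GKdim}(D)\ge 2$, then $Q(A)$ is finite dimensional as a left $D$-vector space.
   Context: For a finitely generated $K$-algebra $A$, $\mathrm{GKdim}(A)=\limsup_{n\to\infty}\log\dim_K(V^n)/\log n$, where $V$ is any finite-dimensional subspace containing $1$ that generates $A$ as a $K$-algebra. For an arbitrary $K$-algebra $B$ (e.g. a division algebra that is not finitely generated as an algebra), $\mathrm{GKdim}(B)$ is the supremum of the GK dimensions of its finitely generated $K$-subalgebras. A finitely generated domain of finite GK dimension is an Ore domain and has a quotient division algebra $Q(A)$. *)

theory Defs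
  imports Complex_Main "HOL-Library.Extended_Real" "HOL-Library.Liminf_Limsup"
begin

text \<open>Setting.  The quotient division algebra Q(A) is modelled as a type 'q of class
division_ring.  The base field K is a type 'k of class field, and the K-algebra
structure of 'q is given by a ring embedding emb of K into the centre of 'q;
scalar multiplication is c . x = emb c * x.\<close>

definition central_emb :: "('k::field \<Rightarrow> 'q::division_ring) \<Rightarrow> bool" where
  "central_emb emb \<longleftrightarrow> emb 1 = 1 \<and> (\<forall>a b. emb (a + b) = emb a + emb b)
     \<and> (\<forall>a b. emb (a * b) = emb a * emb b) \<and> (\<forall>a x. emb a * x = x * emb a)"

definition scl :: "('k::field \<Rightarrow> 'q::division_ring) \<Rightarrow> 'k \<Rightarrow> 'q \<Rightarrow> 'q" where
  "scl emb c x = emb c * x"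

definition kspan :: "('k::field \<Rightarrow> 'q::division_ring) \<Rightarrow> 'q set \<Rightarrow> 'q set" where
  "kspan emb S = module.span (scl emb) S"

definition ksubspace :: "('k::field \<Rightarrow> 'q::division_ring) \<Rightarrow> 'q set \<Rightarrow> bool" where
  "ksubspace emb S = module.subspace (scl emb) S"

definition kfindim :: "('k::field \<Rightarrow> 'q::division_ring) \<Rightarrow> 'q set \<Rightarrow> bool" where
  "kfindim emb V \<longleftrightarrow> (\<exists>F. finite F \<and> V = kspan emb F)"

definition kdim :: "('k::field \<Rightarrow> 'q::division_ring) \<Rightarrow> 'q set \<Rightarrow> nat" where
  "kdim emb V = vector_space.dim (scl emb) V"

definition spow :: "('k::field \<Rightarrow> 'q::division_ring) \<Rightarrow> 'q set \<Rightarrow> nat \<Rightarrow> 'q set" where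
  "spow emb V n = kspan emb {prod_list xs | xs. length xs = n \<and> set xs \<subseteq> V}"

definition ksubalg :: "('k::field \<Rightarrow> 'q::division_ring) \<Rightarrow> 'q set \<Rightarrow> bool" where
  "ksubalg emb B \<longleftrightarrow> ksubspace emb B \<and> 1 \<in> B \<and> (\<forall>x\<in>B. \<forall>y\<in>B. x * y \<in> B)"

definition alg_gen :: "('k::field \<Rightarrow> 'q::division_ring) \<Rightarrow> 'q set \<Rightarrow> 'q set" where
  "alg_gen emb S = \<Inter>{B. ksubalg emb B \<and> S \<subseteq> B}"

definition fg_subalg :: "('k::field \<Rightarrow> 'q::division_ring) \<Rightarrow> 'q set \<Rightarrow> bool" where
  "fg_subalg emb C \<longleftrightarrow> (\<exists>S. finite S \<and> C = alg_gen emb S)"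

definition growth :: "('k::field \<Rightarrow> 'q::division_ring) \<Rightarrow> 'q set \<Rightarrow> ereal" where
  "growth emb V = limsup (\<lambda>n. ereal (ln (real (kdim emb (spow emb V n))) / ln (real n)))"

text \<open>GK dimension of a finitely generated K-algebra C: growth of any (here: some chosen)
finite-dimensional subspace V with 1 in V generating C.\<close>

definition gkdim_fg :: "('k::field \<Rightarrow> 'q::division_ring) \<Rightarrow> 'q set \<Rightarrow> ereal" where
  "gkdim_fg emb C = growth emb
     (SOME V. ksubspace emb V \<and> kfindim emb V \<and> 1 \<in> V \<and> alg_gen emb V = C)"

definition gkdim :: "('k::field \<Rightarrow> 'q::division_ring) \<Rightarrow> 'q set \<Rightarrow> ereal" where
  "gkdim emb B = (SUP C \<in> {C. fg_subalg emb C \<and> C \<subseteq> B}. gkdim_fg emb C)"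

definition div_subalg :: "('k::field \<Rightarrow> 'q::division_ring) \<Rightarrow> 'q set \<Rightarrow> bool" where
  "div_subalg emb D \<longleftrightarrow> ksubalg emb D \<and> (\<forall>x\<in>D. x \<noteq> 0 \<longrightarrow> inverse x \<in> D)"

definition is_quotient_ring :: "'q::division_ring set \<Rightarrow> bool" where
  "is_quotient_ring A \<longleftrightarrow> (\<forall>q. \<exists>a\<in>A. \<exists>s\<in>A. s \<noteq> 0 \<and> q = a * inverse s)"

definition left_findim :: "'q::division_ring set \<Rightarrow> bool" where
  "left_findim D \<longleftrightarrow> (\<exists>F. finite F \<and>
     (\<forall>q. \<exists>c. (\<forall>f\<in>F. c f \<in> D) \<and> q = (\<Sum>f\<in>F. c f * f)))"

end

theory Submission
  imports Defs "HOL-Computational_Algebra.Polynomial"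
    "HOL-Computational_Algebra.Formal_Laurent_Series" "HOL-Real_Asymp.Real_Asymp"
begin

text \<open>
  Let \<open>V\<close> generate \<open>A\<close> and \<open>f n = dim V\<^sup>n\<close>, so that \<open>f n = o(n\<^sup>3)\<close>, and suppose that \<open>Q(A)\<close> has
  infinite left dimension over \<open>D\<close>. Then for every nonzero \<open>u\<close> the space \<open>u V\<^sup>n\<close> contains \<open>n + 1\<close>
  elements that are left independent over \<open>D\<close>: otherwise a finite-dimensional left \<open>D\<close>-space
  containing \<open>u\<close> is stable under right multiplication by \<open>A\<close>, hence by its inverses, and is \<open>Q(A)\<close>.

  Choose a finite set \<open>X \<subseteq> D\<close> generating an algebra of superlinear growth. Over an infinite field
  there are linear combinations \<open>a\<^sub>0, a\<^sub>1, \<dots>\<close> and \<open>b\<^sub>0, b\<^sub>1, \<dots>\<close> of \<open>X\<close> such that the products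
  \<open>P\<^sub>i Q\<^sub>j\<close> with \<open>P\<^sub>i = a\<^sub>0 \<dots> a\<^bsub>i-1\<^esub>\<close> and \<open>Q\<^sub>j = b\<^bsub>j-1\<^esub> \<dots> b\<^sub>0\<close> are linearly independent. By
  genericity it is enough to see this in the monomial algebra of the words that are irreducible for
  the degree-lexicographic order, and there it follows from the existence of a right special word
  of each length in the language of bi-infinitely extendable irreducible words.

  Elements of \<open>X\<close> have common denominators on both sides, so multiplying \<open>V\<^sup>N\<close> by \<open>X\<close> from either
  side enlarges its dimension by at most \<open>f(N + p) - f N\<close>, which is \<open>O(f N / N)\<close> for infinitely many
  \<open>N\<close>. For such \<open>N\<close> and \<open>L = cN\<close> a dimension count yields nonzero \<open>u\<^sub>1, u\<^sub>2 \<in> V\<^sup>N\<close> with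
  \<open>Q\<^sub>j u\<^sub>1 \<in> V\<^sup>N\<close> and \<open>u\<^sub>2 P\<^sub>i \<in> V\<^sup>N\<close> for all \<open>i, j \<le> L\<close>. With \<open>e\<^sub>k \<in> V\<^sup>N\<close> such that the \<open>u\<^sub>1 e\<^sub>k\<close> are
  left independent over \<open>D\<close>, the elements \<open>u\<^sub>2 P\<^sub>i Q\<^sub>j u\<^sub>1 e\<^sub>k\<close> of \<open>V\<^bsup>3N\<^esup>\<close> are linearly independent, and
  their number is of order \<open>N\<^sup>3\<close>.
\<close>

section \<open>Linear algebra over a central field\<close>

text \<open>Gaussian elimination with the unknowns on the left of the coefficients. \<open>D\<close>
  acts as a division subring, so that the solution stays inside it; it is the whole field when
  functionals are evaluated, and a division subalgebra when left coordinates are compared.\<close>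

lemma homogeneous_system:
  fixes a :: "nat \<Rightarrow> nat \<Rightarrow> 'a::division_ring"
  assumes "\<And>x y. x \<in> D \<Longrightarrow> y \<in> D \<Longrightarrow> x + y \<in> D" "\<And>x y. x \<in> D \<Longrightarrow> y \<in> D \<Longrightarrow> x * y \<in> D"
    and "\<And>x. x \<in> D \<Longrightarrow> - x \<in> D" "\<And>x. x \<in> D \<Longrightarrow> inverse x \<in> D" "0 \<in> D" "1 \<in> D"
    and "\<And>i r. i < n \<Longrightarrow> r < m \<Longrightarrow> a i r \<in> D" "m < n"
  shows "\<exists>l. (\<forall>i<n. l i \<in> D) \<and> (\<exists>i<n. l i \<noteq> 0) \<and> (\<forall>r<m. (\<Sum>i<n. l i * a i r) = 0)"
  using assms(7,8)
proof (induction m arbitrary: n a)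
  case 0
  then show ?case using assms(6) by (intro exI[of _ "\<lambda>_. 1"]) auto
next
  case (Suc m)
  show ?case
  proof (cases "\<forall>i<n. a i m = 0")
    case True
    obtain l where "\<forall>i<n. l i \<in> D" "\<exists>i<n. l i \<noteq> 0" "\<forall>r<m. (\<Sum>i<n. l i * a i r) = 0"
      using Suc.IH[of n a] Suc.prems by auto
    then show ?thesis using True by (intro exI[of _ l]) (auto simp: less_Suc_eq)
  next
    case False
    then obtain j where j: "j < n" "a j m \<noteq> 0" by blast
    define sw where "sw i = (if i = j then n - 1 else if i = n - 1 then j else i)" for i
    have swn: "i < n \<Longrightarrow> sw i < n" for i using j by (auto simp: sw_def)
    have swsw: "i < n \<Longrightarrow> sw (sw i) = i" for i by (auto simp: sw_def)
    have bij: "bij_betw sw {..<n} {..<n}"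
      by (rule bij_betw_byWitness[of _ sw]) (auto simp: swn swsw)
    define c where "c i = a (sw i) m * inverse (a j m)" for i
    define b where "b i r = a (sw i) r - c i * a j r" for i r
    have swl: "sw (n - 1) = j" by (auto simp: sw_def)
    have cD: "i < n \<Longrightarrow> c i \<in> D" for i
      unfolding c_def by (intro assms(2) assms(4) Suc.prems(1)) (use swn j in auto)
    have "b i r \<in> D" if "i < n - 1" "r < m" for i r
    proof -
      have "a (sw i) r + - (c i * a j r) \<in> D"
        by (intro assms(1) assms(3) assms(2) cD Suc.prems(1)) (use that swn[of i] j in auto)
      then show ?thesis by (simp add: b_def)
    qed
    moreover have m1: "m < n - 1" using Suc.prems(2) by simp
    ultimately obtain l where l: "\<forall>i<n-1. l i \<in> D" "\<exists>i<n-1. l i \<noteq> 0" "\<forall>r<m. (\<Sum>i<n-1. l i * b i r) = 0"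
      using Suc.IH[of "n - 1" b, OF _ m1] by blast
    have sumD: "finite I \<Longrightarrow> (\<And>i. i \<in> I \<Longrightarrow> g i \<in> D) \<Longrightarrow> sum g I \<in> D" for g :: "nat \<Rightarrow> 'a" and I
      by (induction I rule: finite_induct) (auto intro: assms(1,5))
    define l' where "l' i = (if i < n - 1 then l i else - (\<Sum>i<n-1. l i * c i))" for i
    have "- (\<Sum>i<n-1. l i * c i) \<in> D"
      using l(1) cD by (intro assms(3) sumD) (auto intro!: assms(2))
    then have l'D: "\<forall>i<n. l' i \<in> D" using l(1) by (auto simp: l'_def)
    have eq: "(\<Sum>i<n. l' (sw i) * a i r) = (\<Sum>i<n-1. l i * b i r)" for r
    proof -
      have "(\<Sum>i<n. l' (sw i) * a i r) = (\<Sum>i<n. l' (sw (sw i)) * a (sw i) r)"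
        using sum.reindex_bij_betw[OF bij, of "\<lambda>i. l' (sw i) * a i r"] by simp
      also have "\<dots> = (\<Sum>i<n. l' i * a (sw i) r)" by (intro sum.cong) (auto simp: swsw)
      also have "\<dots> = (\<Sum>i<n-1. l' i * a (sw i) r) + l' (n-1) * a (sw (n-1)) r"
      proof -
        have "{..<n} = insert (n - 1) {..<n-1}" using j by auto
        then show ?thesis by (simp add: add.commute)
      qed
      also have "\<dots> = (\<Sum>i<n-1. l i * a (sw i) r) - (\<Sum>i<n-1. l i * c i) * a j r"
        using swl by (simp add: l'_def)
      also have "\<dots> = (\<Sum>i<n-1. l i * b i r)"
        by (simp add: b_def sum_subtractf sum_distrib_right right_diff_distrib mult.assoc)
      finally show ?thesis .
    qed
    have bm: "b i m = 0" for i using j by (simp add: b_def c_def mult.assoc)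
    have "\<exists>i<n. l' (sw i) \<noteq> 0"
    proof -
      obtain i where i: "i < n - 1" "l i \<noteq> 0" using l(2) by blast
      then have "l' (sw (sw i)) \<noteq> 0" using swsw[of i] by (simp add: l'_def)
      then show ?thesis using swn[of i] i by (intro exI[of _ "sw i"]) auto
    qed
    moreover have "(\<Sum>i<n. l' (sw i) * a i r) = 0" if "r < Suc m" for r
      using that l(3) bm by (cases "r = m") (auto simp: eq)
    ultimately show ?thesis
      using l'D swn by (intro exI[of _ "\<lambda>i. l' (sw i)"]) auto
  qed
qed

text \<open>Fraction-free elimination: a pivot that does not vanish at \<open>e\<close> is a nonzero
  polynomial, and \<open>d\<close> is the product of the pivots. This takes the place of a maximal
  minor and allows infinitely many rows.\<close>

lemma columns_independent_cofinitely:
  fixes N :: "'r \<Rightarrow> nat \<Rightarrow> 'k::field poly"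
  assumes "\<And>l. (\<forall>r\<in>R. (\<Sum>i<n. l i * poly (N r i) e) = 0) \<Longrightarrow> \<forall>i<n. l i = 0"
  shows "\<exists>d. d \<noteq> 0 \<and> (\<forall>t. poly d t \<noteq> 0 \<longrightarrow>
           (\<forall>l. (\<forall>r\<in>R. (\<Sum>i<n. l i * poly (N r i) t) = 0) \<longrightarrow> (\<forall>i<n. l i = 0)))"
  using assms
proof (induction n arbitrary: N)
  case 0
  then show ?case by (intro exI[of _ 1]) auto
next
  case (Suc n)
  obtain r0 where r0: "r0 \<in> R" "poly (N r0 n) e \<noteq> 0"
  proof (rule ccontr)
    assume "\<not> thesis"
    then have "\<forall>r\<in>R. poly (N r n) e = 0" using that by blast
    then have "\<forall>i<Suc n. (if i = n then 1 else 0 :: 'k) = 0"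
      by (intro Suc.prems) (auto simp: if_distrib[of "\<lambda>x. x * _"] cong: if_cong)
    then show False by auto
  qed
  define N' where "N' r i = N r0 n * N r i - N r n * N r0 i" for r i
  have key: "(\<Sum>i<n. l i * poly (N' r i) t)
      = poly (N r0 n) t * (\<Sum>i<n. l i * poly (N r i) t) - poly (N r n) t * (\<Sum>i<n. l i * poly (N r0 i) t)"
    for l r t
    by (simp add: N'_def sum_distrib_left sum_subtractf algebra_simps)
  have "\<forall>i<n. l i = 0" if l: "\<forall>r\<in>R. (\<Sum>i<n. l i * poly (N' r i) e) = 0" for l
  proof -
    define m where "m i = (if i < n then l i * poly (N r0 n) e else - (\<Sum>i<n. l i * poly (N r0 i) e))" for i
    have "(\<Sum>i<Suc n. m i * poly (N r i) e) = (\<Sum>i<n. l i * poly (N' r i) e)" for r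
      unfolding key by (simp add: m_def sum_distrib_left algebra_simps)
    then have "\<forall>i<Suc n. m i = 0" using l by (intro Suc.prems) auto
    then show ?thesis using r0(2) by (auto simp: m_def less_Suc_eq)
  qed
  from Suc.IH[OF this] obtain d where d: "d \<noteq> 0"
    "\<And>t l. poly d t \<noteq> 0 \<Longrightarrow> (\<forall>r\<in>R. (\<Sum>i<n. l i * poly (N' r i) t) = 0) \<Longrightarrow> (\<forall>i<n. l i = 0)" by blast
  have "\<forall>i<Suc n. l i = 0" if t: "poly (d * N r0 n) t \<noteq> 0"
    and l: "\<forall>r\<in>R. (\<Sum>i<Suc n. l i * poly (N r i) t) = 0" for t l
  proof -
    have s: "(\<Sum>i<n. l i * poly (N r i) t) = - (l n * poly (N r n) t)" if "r \<in> R" for r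
      using l that by (auto simp: eq_neg_iff_add_eq_0)
    have "\<forall>i<n. l i = 0"
      by (rule d(2)[of t]) (use t s r0 in \<open>auto simp: key\<close>)
    moreover from this have "l n = 0" using s[OF r0(1)] t by auto
    ultimately show ?thesis by (auto simp: less_Suc_eq)
  qed
  then show ?case using d(1) r0 by (intro exI[of _ "d * N r0 n"]) auto
qed

section \<open>Linear functionals, independent families and dimension\<close>

definition klinear :: "('k::field \<Rightarrow> 'q::division_ring) \<Rightarrow> ('q \<Rightarrow> 'k) \<Rightarrow> bool" where
  "klinear emb \<phi> \<longleftrightarrow> (\<forall>x y. \<phi> (x + y) = \<phi> x + \<phi> y) \<and> (\<forall>c x. \<phi> (emb c * x) = c * \<phi> x)"

text \<open>Families are indexed, so that a repeated value already counts as a dependence and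
  \<open>card I\<close> can be compared with dimensions.\<close>

definition kindep :: "('k::field \<Rightarrow> 'q::division_ring) \<Rightarrow> 'i set \<Rightarrow> ('i \<Rightarrow> 'q) \<Rightarrow> bool" where
  "kindep emb I v \<longleftrightarrow> (\<forall>l. (\<Sum>i\<in>I. emb (l i) * v i) = 0 \<longrightarrow> (\<forall>i\<in>I. l i = 0))"

locale central_algebra =
  fixes emb :: "'k::field \<Rightarrow> 'q::division_ring"
  assumes emb: "central_emb emb"
begin

lemma emb_1 [simp]: "emb 1 = 1" and emb_add: "emb (a + b) = emb a + emb b"
  and emb_mult: "emb (a * b) = emb a * emb b" and emb_comm: "emb a * x = x * emb a"
  using emb unfolding central_emb_def by blast+

lemma emb_0 [simp]: "emb 0 = 0"
  using emb_add[of 0 0] by simp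

lemma emb_minus: "emb (- a) = - emb a"
  using emb_add[of a "- a"] by (simp add: eq_neg_iff_add_eq_0 add.commute)

lemma emb_sum: "emb (sum g I) = (\<Sum>i\<in>I. emb (g i))"
  by (induction I rule: infinite_finite_induct) (auto simp: emb_add)

lemma emb_eq_0_iff [simp]: "emb a = 0 \<longleftrightarrow> a = 0"
proof
  assume "emb a = 0"
  then have "emb (a * inverse a) = 0" by (simp add: emb_mult)
  then show "a = 0" by (cases "a = 0") auto
qed simp

lemma emb_left_comm: "x * (emb a * y) = emb a * (x * y)"
  by (metis emb_comm mult.assoc)

sublocale vs: vector_space "scl emb"
  by unfold_locales (auto simp: scl_def algebra_simps emb_add emb_mult)

lemma kspan_eq: "kspan emb = vs.span" and kdim_eq: "kdim emb = vs.dim"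
  and ksubspace_eq: "ksubspace emb = vs.subspace"
  by (auto simp: fun_eq_iff kspan_def kdim_def ksubspace_def)

lemma klinear_0: "klinear emb \<phi> \<Longrightarrow> \<phi> 0 = 0"
  unfolding klinear_def by (metis mult_zero_left emb_0)

lemma klinear_sum: "klinear emb \<phi> \<Longrightarrow> \<phi> (\<Sum>i\<in>I. emb (c i) * x i) = (\<Sum>i\<in>I. c i * \<phi> (x i))"
proof (induction I rule: infinite_finite_induct)
  case (insert i I)
  then show ?case by (simp add: klinear_def)
qed (auto simp: klinear_0)

lemma klinear_mult_left: "klinear emb \<phi> \<Longrightarrow> klinear emb (\<lambda>x. \<phi> (q * x))"
  by (simp add: klinear_def algebra_simps emb_left_comm)

lemma klinear_mult_right: "klinear emb \<phi> \<Longrightarrow> klinear emb (\<lambda>x. \<phi> (x * q))"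
  by (simp add: klinear_def algebra_simps)

lemma klinear_representation:
  assumes "vs.independent B" "vs.span B = UNIV"
  shows "klinear emb (\<lambda>x. vs.representation B x b)"
  using vs.representation_add[OF assms(1)] vs.representation_scale[OF assms(1)] assms(2)
  by (auto simp: klinear_def scl_def)

lemma klinear_zero_on_span:
  assumes "klinear emb \<phi>" "\<And>x. x \<in> S \<Longrightarrow> \<phi> x = 0" "x \<in> kspan emb S"
  shows "\<phi> x = 0"
proof -
  have "x \<in> vs.span S" using assms(3) by (simp add: kspan_eq)
  then show ?thesis
  proof (induction rule: vs.span_induct)
    case base
    show ?case using assms(1) klinear_0[OF assms(1)]
      by (auto simp: vs.subspace_def klinear_def scl_def)
  qed (use assms in auto)
qed

lemma kspan_two_sided:
  assumes "y \<in> kspan emb S" "\<And>z. z \<in> S \<Longrightarrow> u * z * r \<in> kspan emb S'"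
  shows "u * y * r \<in> kspan emb S'"
proof -
  have "y \<in> vs.span S" using assms(1) by (simp add: kspan_eq)
  then show ?thesis
  proof (induction rule: vs.span_induct)
    case base
    have "vs.subspace {y. u * y * r \<in> vs.span S'}"
      unfolding vs.subspace_def
    proof (intro conjI ballI allI; clarsimp)
      show "0 \<in> vs.span S'" by (rule vs.span_zero)
      show "u * (a + b) * r \<in> vs.span S'" if "u * a * r \<in> vs.span S'" "u * b * r \<in> vs.span S'" for a b
        using vs.span_add[OF that] by (simp add: algebra_simps)
      show "u * scl emb c a * r \<in> vs.span S'" if "u * a * r \<in> vs.span S'" for c a
        using vs.span_scale[OF that, of c] by (simp add: scl_def emb_left_comm mult.assoc)
    qed
    then show ?case by (simp add: kspan_eq)
  qed (use assms in auto)
qed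

text \<open>The vector is adjoined to a basis of the span of \<open>S\<close>, and this is extended
  to a basis of everything; the functional is the coordinate at \<open>v\<close>.\<close>

lemma separating_functional:
  assumes "v \<notin> kspan emb S"
  obtains \<phi> where "klinear emb \<phi>" "\<And>x. x \<in> S \<Longrightarrow> \<phi> x = 0" "\<phi> v = 1"
proof -
  obtain B where B: "B \<subseteq> S" "vs.independent B" "S \<subseteq> vs.span B"
    using vs.maximal_independent_subset by blast
  have "v \<notin> vs.span B" using assms B(1) vs.span_mono by (auto simp: kspan_eq)
  then have ind: "vs.independent (insert v B)" using B(2) by (rule vs.independent_insertI)
  define E where "E = vs.extend_basis (insert v B)"
  have E: "vs.independent E" "vs.span E = UNIV" "insert v B \<subseteq> E"
    unfolding E_def using vs.independent_extend_basis[OF ind] vs.span_extend_basis[OF ind]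
      vs.extend_basis_superset[OF ind] by auto
  define \<phi> where "\<phi> x = vs.representation E x v" for x
  have lin: "klinear emb \<phi>" unfolding \<phi>_def by (rule klinear_representation[OF E(1,2)])
  have "\<phi> b = 0" if "b \<in> B" for b
  proof -
    have "b \<noteq> v" using that \<open>v \<notin> vs.span B\<close> vs.span_base by auto
    then show ?thesis using that E by (auto simp: \<phi>_def vs.representation_basis)
  qed
  then have "\<phi> x = 0" if "x \<in> S" for x
    using klinear_zero_on_span[OF lin, of B x] that B(3) by (auto simp: kspan_eq)
  moreover have "\<phi> v = 1" using E by (auto simp: \<phi>_def vs.representation_basis)
  ultimately show ?thesis using that lin by blast
qed

lemma kindep_card_le:
  assumes "finite I" "kindep emb I v" "v ` I \<subseteq> kspan emb F" "finite F"
  shows "card I \<le> card F"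
proof -
  have inj: "inj_on v I"
  proof (rule inj_onI, rule ccontr)
    fix i j assume ij: "i \<in> I" "j \<in> I" "v i = v j" "i \<noteq> j"
    define l :: "_ \<Rightarrow> 'k" where "l k = (if k = i then 1 else if k = j then -1 else 0)" for k
    have "(\<Sum>k\<in>I. emb (l k) * v k) = (\<Sum>k\<in>{i, j}. emb (l k) * v k)"
      using ij assms(1) by (intro sum.mono_neutral_right) (auto simp: l_def)
    also have "\<dots> = 0" using ij by (simp add: l_def emb_minus)
    finally have "l i = 0" using assms(2) ij(1) by (auto simp: kindep_def)
    then show False by (simp add: l_def)
  qed
  have "vs.independent (v ` I)"
  proof (rule vs.independent_if_scalars_zero)
    show "finite (v ` I)" using assms(1) by simp
    fix f x assume f: "(\<Sum>x\<in>v ` I. scl emb (f x) x) = 0" "x \<in> v ` I"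
    have "(\<Sum>i\<in>I. emb (f (v i)) * v i) = 0"
      using f(1) by (simp add: sum.reindex[OF inj] scl_def)
    then show "f x = 0" using assms(2)[unfolded kindep_def, rule_format, of "\<lambda>i. f (v i)"] f(2) by auto
  qed
  then have "card (v ` I) \<le> card F"
    using vs.independent_span_bound[of F "v ` I"] assms by (auto simp: kspan_eq)
  then show ?thesis by (simp add: card_image[OF inj])
qed

lemma finite_basis:
  assumes "finite F" "V \<subseteq> kspan emb F"
  obtains B where "B \<subseteq> V" "finite B" "vs.independent B" "V \<subseteq> kspan emb B" "card B = kdim emb V"
proof -
  obtain B where B: "B \<subseteq> V" "vs.independent B" "V \<subseteq> vs.span B" "card B = vs.dim V"
    using vs.basis_exists by blast
  have "finite B"
    using vs.independent_span_bound[OF assms(1) B(2)] B(1) assms(2) by (auto simp: kspan_eq)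
  then show ?thesis using that B by (auto simp: kspan_eq kdim_eq)
qed

lemma kindep_le_kdim:
  assumes "finite I" "kindep emb I v" "v ` I \<subseteq> V" "finite F" "V \<subseteq> kspan emb F"
  shows "card I \<le> kdim emb V"
proof -
  obtain B where "finite B" "V \<subseteq> kspan emb B" "card B = kdim emb V"
    using finite_basis[OF assms(4,5)] by metis
  then show ?thesis using kindep_card_le[OF assms(1,2), of B] assms(3) by auto
qed

lemma kdim_ge_1:
  assumes "finite F" "V \<subseteq> kspan emb F" "1 \<in> V"
  shows "kdim emb V \<ge> 1"
proof -
  have "kindep emb {()} (\<lambda>_. 1)" by (auto simp: kindep_def)
  then have "card {()} \<le> kdim emb V"
    by (rule kindep_le_kdim[OF _ _ _ assms(1,2), rotated]) (use assms(3) in auto)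
  then show ?thesis by simp
qed

lemma kindep_independent:
  assumes "finite B" "vs.independent B"
  shows "kindep emb B (\<lambda>x. x)"
  unfolding kindep_def
proof (intro allI impI ballI)
  fix l x assume "(\<Sum>i\<in>B. emb (l i) * i) = 0" "x \<in> B"
  then show "l x = 0"
    using vs.independentD[OF assms(2,1), of l x] by (auto simp: scl_def)
qed

text \<open>A basis of \<open>S\<close> is extended to a basis of \<open>H\<close>; the coordinates
  at the added vectors are as many conditions as the codimension, and they cut out \<open>S\<close>
  inside \<open>H\<close>.\<close>

lemma codimension_functionals:
  assumes "finite F" "H \<subseteq> kspan emb F" "S \<subseteq> H" "ksubspace emb S"
  obtains \<Psi> where "finite \<Psi>" "card \<Psi> + kdim emb S = kdim emb H" "\<And>\<psi>. \<psi> \<in> \<Psi> \<Longrightarrow> klinear emb \<psi>"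
    "\<And>h. h \<in> H \<Longrightarrow> (\<And>\<psi>. \<psi> \<in> \<Psi> \<Longrightarrow> \<psi> h = 0) \<Longrightarrow> h \<in> S"
proof -
  obtain B where B: "B \<subseteq> S" "finite B" "vs.independent B" "S \<subseteq> kspan emb B" "card B = kdim emb S"
    using finite_basis[OF assms(1), of S] assms(2,3) by auto
  obtain C where C: "B \<subseteq> C" "C \<subseteq> H" "vs.independent C" "H \<subseteq> vs.span C"
    using vs.maximal_independent_subset_extend[of B H] B assms(3) by blast
  have fC: "finite C"
    using vs.independent_span_bound[OF assms(1) C(3)] C(2) assms(2) by (auto simp: kspan_eq)
  have cC: "card C = kdim emb H" using vs.basis_card_eq_dim C by (simp add: kdim_eq)
  define E where "E = vs.extend_basis C"
  have E: "vs.independent E" "vs.span E = UNIV" "C \<subseteq> E"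
    unfolding E_def using vs.independent_extend_basis[OF C(3)] vs.span_extend_basis[OF C(3)]
      vs.extend_basis_superset[OF C(3)] by auto
  define \<rho> where "\<rho> b x = vs.representation E x b" for b x
  have \<rho>b: "\<rho> b c = (if c = b then 1 else 0)" if "c \<in> E" for b c
    using that E by (simp add: \<rho>_def vs.representation_basis)
  have lin: "klinear emb (\<rho> b)" for b
    unfolding \<rho>_def by (rule klinear_representation[OF E(1,2)])
  have injr: "inj_on \<rho> (C - B)"
  proof (rule inj_onI)
    fix b c assume bc: "b \<in> C - B" "c \<in> C - B" "\<rho> b = \<rho> c"
    then have "\<rho> c b = 1" using \<rho>b[of b b] E(3) by auto
    then show "b = c" using \<rho>b[of b c] E(3) bc by (auto split: if_splits)
  qed
  have "h \<in> S" if h: "h \<in> H" "\<And>\<psi>. \<psi> \<in> \<rho> ` (C - B) \<Longrightarrow> \<psi> h = 0" for h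
  proof -
    have hs: "h \<in> vs.span C" using h(1) C(4) by auto
    then obtain r where r: "h = (\<Sum>c\<in>C. scl emb (r c) c)"
      using vs.span_finite[OF fC] by auto
    have "r b = 0" if b: "b \<in> C - B" for b
    proof -
      have "\<rho> b h = (\<Sum>c\<in>C. r c * \<rho> b c)"
        unfolding r by (simp add: scl_def klinear_sum[OF lin])
      also have "\<dots> = (\<Sum>c\<in>C. if c = b then r c else 0)"
        using E(3) by (intro sum.cong) (auto simp: \<rho>b)
      also have "\<dots> = r b" using b fC by simp
      finally show ?thesis using h(2)[of "\<rho> b"] b by simp
    qed
    then have "h = (\<Sum>c\<in>B. scl emb (r c) c)"
      unfolding r using fC C(1) by (intro sum.mono_neutral_right) auto
    moreover have "\<dots> \<in> S"
      using assms(4) B(1) by (auto simp: ksubspace_eq intro!: vs.subspace_sum vs.subspace_scale)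
    ultimately show ?thesis by simp
  qed
  moreover have "card (\<rho> ` (C - B)) + kdim emb S = kdim emb H"
    using card_image[OF injr] card_Diff_subset[OF B(2) C(1)] card_mono[OF fC C(1)] B(5) cC by simp
  ultimately show ?thesis using that[of "\<rho> ` (C - B)"] fC lin by blast
qed

text \<open>Evaluated on a basis of \<open>V\<close>, the functionals form a homogeneous system with
  fewer equations than unknowns.\<close>

lemma common_zero:
  assumes "finite \<Phi>" "\<And>\<phi>. \<phi> \<in> \<Phi> \<Longrightarrow> klinear emb \<phi>" "card \<Phi> < kdim emb V"
    and "finite F" "V \<subseteq> kspan emb F" "ksubspace emb V"
  obtains v where "v \<in> V" "v \<noteq> 0" "\<And>\<phi>. \<phi> \<in> \<Phi> \<Longrightarrow> \<phi> v = 0"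
proof -
  obtain B where B: "B \<subseteq> V" "finite B" "vs.independent B" "card B = kdim emb V"
    using finite_basis[OF assms(4,5)] by metis
  obtain b where b: "bij_betw b {..<card B} B" using ex_bij_betw_nat_finite[OF B(2)] by (auto simp: atLeast0LessThan)
  obtain p where p: "bij_betw p {..<card \<Phi>} \<Phi>" using ex_bij_betw_nat_finite[OF assms(1)] by (auto simp: atLeast0LessThan)
  obtain l :: "nat \<Rightarrow> 'k" where l: "\<exists>i<card B. l i \<noteq> 0" "\<forall>r<card \<Phi>. (\<Sum>i<card B. l i * p r (b i)) = 0"
    using homogeneous_system[of UNIV "card B" "card \<Phi>" "\<lambda>i r. p r (b i)"] assms(3) B(4) by auto
  define v where "v = (\<Sum>i<card B. emb (l i) * b i)"
  have bB: "i < card B \<Longrightarrow> b i \<in> B" for i using b by (auto simp: bij_betw_def)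
  have "v \<in> V" unfolding v_def
    using assms(6) bB B(1) by (auto simp: ksubspace_eq scl_def[symmetric] intro!: vs.subspace_sum vs.subspace_scale)
  moreover have "v \<noteq> 0"
  proof
    assume v0: "v = 0"
    have bb: "i < card B \<Longrightarrow> the_inv_into {..<card B} b (b i) = i" for i
      using b by (auto simp: bij_betw_def the_inv_into_f_f)
    have "(\<Sum>x\<in>B. emb (l (the_inv_into {..<card B} b x)) * x) = v"
      unfolding v_def using sum.reindex_bij_betw[OF b, of "\<lambda>x. emb (l (the_inv_into {..<card B} b x)) * x"] bb by simp
    then have "\<forall>x\<in>B. l (the_inv_into {..<card B} b x) = 0"
      using kindep_independent[OF B(2,3)] v0
      by (auto simp: kindep_def dest!: spec[of _ "\<lambda>x. l (the_inv_into {..<card B} b x)"])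
    then show False using l(1) bB bb by metis
  qed
  moreover have "\<phi> v = 0" if "\<phi> \<in> \<Phi>" for \<phi>
  proof -
    have "\<phi> \<in> p ` {..<card \<Phi>}" using that p by (simp add: bij_betw_def)
    then obtain r where "r < card \<Phi>" "\<phi> = p r" by auto
    then show ?thesis
      using l(2) klinear_sum[OF assms(2)[OF that], of l b "{..<card B}"] by (simp add: v_def)
  qed
  ultimately show ?thesis using that by blast
qed

end

section \<open>Irreducible words\<close>

locale word_algebra = central_algebra emb
  for emb :: "'k::field \<Rightarrow> 'q::division_ring" +
  fixes x :: "nat \<Rightarrow> 'q" and q :: nat
begin

definition ev :: "nat list \<Rightarrow> 'q" where "ev w = prod_list (map x w)"

text \<open>The base \<open>q\<close> number with the first letter as leading digit: on words of
  equal length with letters below \<open>q\<close> its order is lexicographic. Later it is also the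
  exponent of a degeneration.\<close>

definition val :: "nat list \<Rightarrow> nat" where "val w = foldl (\<lambda>a z. a * q + z) 0 w"

definition words :: "nat \<Rightarrow> nat list set" where "words m = {w. length w = m \<and> set w \<subseteq> {..<q}}"

definition below :: "nat list \<Rightarrow> nat list set" where
  "below w = {v. set v \<subseteq> {..<q} \<and> (length v < length w \<or> length v = length w \<and> val v < val w)}"

text \<open>These are the normal words of Groebner basis theory, those that are not the leading word
  of a relation in the degree-lexicographic order.\<close>

definition irr :: "nat list \<Rightarrow> bool" where
  "irr w \<longleftrightarrow> set w \<subseteq> {..<q} \<and> ev w \<notin> kspan emb (ev ` below w)"

lemma ev_append [simp]: "ev (u @ v) = ev u * ev v" by (simp add: ev_def)

lemma val_foldl: "foldl (\<lambda>a z. a * q + z) c v = c * q ^ length v + val v"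
proof (induction v rule: rev_induct)
  case (snoc z v)
  then show ?case by (simp add: val_def algebra_simps)
qed (simp add: val_def)

lemma val_append: "val (u @ v) = val u * q ^ length v + val v"
  using val_foldl[of "val u" v] by (simp add: val_def)

lemma val_Nil [simp]: "val [] = 0" and val_single [simp]: "val [z] = z"
  by (simp_all add: val_def)

lemma val_inj: "u \<in> words m \<Longrightarrow> v \<in> words m \<Longrightarrow> val u = val v \<Longrightarrow> u = v"
proof (induction m arbitrary: u v)
  case (Suc m)
  obtain u' a where u: "u = u' @ [a]" using Suc.prems(1) by (cases u rule: rev_cases) (auto simp: words_def)
  obtain v' b where v: "v = v' @ [b]" using Suc.prems(2) by (cases v rule: rev_cases) (auto simp: words_def)
  have ab: "a < q" "b < q" using Suc.prems u v by (auto simp: words_def)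
  have e: "val u' * q + a = val v' * q + b" using Suc.prems(3) by (simp add: u v val_append)
  have "a = b" using arg_cong[OF e, of "\<lambda>n. n mod q"] ab by simp
  with e ab have "val u' = val v'" by simp
  then have "u' = v'" using Suc.prems(1,2) by (intro Suc.IH) (auto simp: words_def u v)
  then show ?case using \<open>a = b\<close> u v by simp
qed (simp add: words_def)

text \<open>The digit expansion lets a power with exponent \<open>val w\<close> be split into one
  factor per letter.\<close>

lemma val_nth: "length w = m \<Longrightarrow> val w = (\<Sum>s<m. w ! s * q ^ (m - 1 - s))"
proof (induction w arbitrary: m rule: rev_induct)
  case (snoc z w)
  have "(\<Sum>s<length w. (w @ [z]) ! s * q ^ (length w - s)) = (\<Sum>s<length w. w ! s * q ^ (length w - 1 - s)) * q"
    unfolding sum_distrib_right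
    by (intro sum.cong) (auto simp: nth_append mult.assoc power_Suc2[symmetric] Suc_diff_Suc simp del: power_Suc)
  then show ?case using snoc by (auto simp: val_append)
qed simp

lemma finite_words [simp]: "finite (words m)"
  using finite_lists_length_eq[of "{..<q}" m] by (simp add: words_def conj_commute)

text \<open>The order is compatible with multiplication on both sides, so rewriting a factor through
  smaller words rewrites the whole word through smaller words.\<close>

lemma irr_factor: "irr (u @ v @ r) \<Longrightarrow> irr v"
proof (rule ccontr)
  assume i: "irr (u @ v @ r)" and n: "\<not> irr v"
  have "ev u * ev v * ev r \<in> kspan emb (ev ` below (u @ v @ r))"
  proof (rule kspan_two_sided)
    show "ev v \<in> kspan emb (ev ` below v)" using i n by (auto simp: irr_def)
    fix z assume "z \<in> ev ` below v"
    then obtain v' where v': "v' \<in> below v" "z = ev v'" by blast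
    have "u @ v' @ r \<in> below (u @ v @ r)"
    proof (cases "length v' < length v")
      case True
      then show ?thesis using i v' by (auto simp: below_def irr_def)
    next
      case False
      \<comment> \<open>The comparison of values needs \<open>q ^ length r\<close> to be positive;
        for \<open>q = 0\<close> there are no letters and \<open>r\<close> is empty.\<close>
      have "q > 0" if "r \<noteq> []" using that i by (cases r) (auto simp: irr_def)
      then have "q ^ length r > 0" by (cases "r = []") auto
      then show ?thesis using False i v' by (auto simp: below_def irr_def val_append)
    qed
    then show "ev u * z * ev r \<in> kspan emb (ev ` below (u @ v @ r))"
      unfolding kspan_eq v'(2) by (intro vs.span_base) (auto simp: mult.assoc intro!: image_eqI[of _ _ "u @ v' @ r"])
  qed
  then show False using i by (simp add: irr_def mult.assoc)
qed

text \<open>Rewriting terminates because the pair of length and value decreases, and it never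
  lengthens a word.\<close>

lemma irr_span:
  "set w \<subseteq> {..<q} \<Longrightarrow> ev w \<in> kspan emb (ev ` {v. irr v \<and> length v \<le> length w})"
proof (induction w rule: wf_induct_rule[OF wf_measures[of "[length, val]"]])
  case (1 w)
  show ?case
  proof (cases "irr w")
    case True
    then show ?thesis unfolding kspan_eq by (intro vs.span_base) auto
  next
    case False
    then have "ev w \<in> vs.span (ev ` below w)" using 1 by (auto simp: irr_def kspan_eq)
    moreover have "ev ` below w \<subseteq> vs.span (ev ` {v. irr v \<and> length v \<le> length w})"
    proof
      fix y assume "y \<in> ev ` below w"
      then obtain v where v: "v \<in> below w" "y = ev v" by blast
      then have "ev v \<in> vs.span (ev ` {v'. irr v' \<and> length v' \<le> length v})"
        using 1(1)[of v] by (auto simp: below_def kspan_eq)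
      moreover have "length v \<le> length w" using v by (auto simp: below_def)
      ultimately show "y \<in> vs.span (ev ` {v. irr v \<and> length v \<le> length w})"
        using vs.span_mono[of "ev ` {v'. irr v' \<and> length v' \<le> length v}" "ev ` {v. irr v \<and> length v \<le> length w}"] v(2)
        by force
    qed
    ultimately show ?thesis unfolding kspan_eq using vs.span_minimal[OF _ vs.subspace_span] by blast
  qed
qed

lemma irr_words: "irr w \<Longrightarrow> w \<in> words (length w)" by (simp add: irr_def words_def)

text \<open>Irreducible words of length at most \<open>n\<close> span the values of all words of
  length at most \<open>n\<close>, so bounded counts force linear growth. Used
  contrapositively.\<close>

lemma irr_count_bound:
  assumes "\<And>m. card {w. irr w \<and> length w = m} \<le> M"
    and "finite T" "\<And>w. w \<in> T \<Longrightarrow> set w \<subseteq> {..<q} \<and> length w \<le> n" "kindep emb T ev"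
  shows "card T \<le> M * (n + 1)"
proof -
  have fin: "finite {w. irr w \<and> length w = m}" for m
    by (rule finite_subset[OF _ finite_words[of m]]) (auto dest: irr_words)
  have un: "{w. irr w \<and> length w \<le> n} = (\<Union>m\<in>{..n}. {w. irr w \<and> length w = m})" by auto
  define F where "F = ev ` {w. irr w \<and> length w \<le> n}"
  have "finite F" unfolding F_def un using fin by auto
  moreover have "ev ` T \<subseteq> kspan emb F"
  proof
    fix y assume "y \<in> ev ` T"
    then obtain w where w: "w \<in> T" "y = ev w" by blast
    then have "y \<in> vs.span (ev ` {v. irr v \<and> length v \<le> length w})" using irr_span[of w] assms(3) by (auto simp: kspan_eq)
    then show "y \<in> kspan emb F" unfolding kspan_eq F_def
      using vs.span_mono[of "ev ` {v. irr v \<and> length v \<le> length w}" "ev ` {w. irr w \<and> length w \<le> n}"] assms(3)[OF w(1)] by force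
  qed
  ultimately have "card T \<le> card F" using kindep_card_le[OF assms(2,4)] by blast
  also have "\<dots> \<le> card {w. irr w \<and> length w \<le> n}" unfolding F_def un using fin by (intro card_image_le) auto
  also have "\<dots> \<le> (\<Sum>m\<in>{..n}. card {w. irr w \<and> length w = m})" unfolding un by (rule card_UN_le) simp
  also have "\<dots> \<le> (\<Sum>m\<in>{..n}. M)" using assms(1) by (intro sum_mono) auto
  also have "\<dots> = M * (n + 1)" by simp
  finally show ?thesis .
qed

section \<open>Words extendable on both sides\<close>

definition ext :: "nat \<Rightarrow> nat list \<Rightarrow> bool" where
  "ext k w \<longleftrightarrow> (\<exists>u r. length u = k \<and> length r = k \<and> irr (u @ w @ r))"

text \<open>As the alphabet is finite, this is the finitary form of occurring in a bi-infinite word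
  all of whose finite factors are irreducible.\<close>

definition biext :: "nat list \<Rightarrow> bool" where "biext w \<longleftrightarrow> (\<forall>k. ext k w)"

lemma ext_mono: "ext k w \<Longrightarrow> j \<le> k \<Longrightarrow> ext j w"
proof -
  assume "ext k w" "j \<le> k"
  then obtain u r where ur: "length u = k" "length r = k" "irr (u @ w @ r)" by (auto simp: ext_def)
  have "u @ w @ r = take (k - j) u @ (drop (k - j) u @ w @ take j r) @ drop j r" by simp
  then have "irr (drop (k - j) u @ w @ take j r)" using ur(3) irr_factor by metis
  then show "ext j w" using ur \<open>j \<le> k\<close> unfolding ext_def
    by (intro exI[of _ "drop (k - j) u"] exI[of _ "take j r"]) auto
qed

lemma biext_irr: "biext w \<Longrightarrow> irr w"
  unfolding biext_def ext_def by (drule spec[of _ 0]) auto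

text \<open>Every failing letter fails from some extension length on. The letters are finitely many,
  so one long enough extension of \<open>w\<close> refutes the failure of the letter that follows
  \<open>w\<close> in it.\<close>

lemma biext_extend:
  assumes "biext w" shows "\<exists>z. biext (w @ [z])"
proof (rule ccontr)
  assume "\<not> ?thesis"
  then have "\<forall>z. \<exists>k. \<not> ext k (w @ [z])" by (auto simp: biext_def)
  then obtain K where K: "\<And>z. \<not> ext (K z) (w @ [z])" by metis
  define k where "k = Max (insert 0 (K ` {..<q}))"
  obtain u r where ur: "length u = Suc k" "length r = Suc k" "irr (u @ w @ r)"
    using assms unfolding biext_def ext_def by blast
  obtain z r' where r: "r = z # r'" using ur(2) by (cases r) auto
  have "z < q" using ur(3) r by (auto simp: irr_def)
  have "u @ w @ r = take 1 u @ (drop 1 u @ (w @ [z]) @ r') @ []" by (simp add: r)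
  then have "irr (drop 1 u @ (w @ [z]) @ r')" using ur(3) irr_factor by metis
  then have "ext k (w @ [z])" using ur r unfolding ext_def
    by (intro exI[of _ "drop 1 u"] exI[of _ r']) auto
  moreover have "K z \<le> k" using \<open>z < q\<close> by (auto simp: k_def)
  ultimately show False using K[of z] ext_mono by blast
qed

text \<open>Otherwise each word of length \<open>n\<close> has at most one biextendable
  continuation. Away from its ends an irreducible word is then deterministic, each letter following
  from the \<open>n\<close> letters before it. Its two ends determine it, and the number of
  irreducible words of each length is bounded.\<close>

lemma right_special:
  assumes "\<And>M. \<exists>m. card {w. irr w \<and> length w = m} > M"
  shows "\<exists>u a b. length u = n \<and> a \<noteq> b \<and> biext (u @ [a]) \<and> biext (u @ [b])"
proof (rule ccontr)
  assume "\<not> ?thesis"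
  then have uniq: "a = b" if "length u = n" "biext (u @ [a])" "biext (u @ [b])" for u a b
    using that by blast
  have "\<forall>w. \<exists>k. \<not> biext w \<longrightarrow> \<not> ext k w" by (auto simp: biext_def)
  then obtain K where K: "\<And>w. \<not> biext w \<Longrightarrow> \<not> ext (K w) w" by metis
  \<comment> \<open>A single \<open>k\<close> decides biextendability for all words of length
    \<open>n + 1\<close>.\<close>
  define k where "k = Max (insert 0 (K ` words (Suc n)))"
  have bi: "biext w" if w: "w \<in> words (Suc n)" "ext k w" for w
  proof (rule ccontr)
    assume "\<not> biext w"
    moreover have "K w \<le> k" using w(1) by (auto simp: k_def)
    ultimately show False using K ext_mono[OF w(2)] by blast
  qed
  have inj: "w = w'" if irr: "irr w" "irr w'" and len: "length w = m" "length w' = m"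
    and tk: "take (k + n) w = take (k + n) w'" and dr: "drop (m - k) w = drop (m - k) w'" for w w' m
  proof (rule nth_equalityI)
    show "length w = length w'" using len by simp
    fix i assume "i < length w"
    then have "i < m" using len by simp
    then show "w ! i = w' ! i"
    proof (induction i rule: less_induct)
      case (less i)
      consider "i < k + n" | "i \<ge> m - k" "i \<ge> k + n" | "i \<ge> k + n" "i < m - k" by linarith
      then show ?case
      proof cases
        case 1
        then show ?thesis using tk less.prems by (metis nth_take)
      next
        case 2
        then show ?thesis using arg_cong[OF dr, of "\<lambda>l. l ! (i - (m - k))"] less.prems len by simp
      next
        case 3
        define u where "u v = take n (drop (i - n) v)" for v :: "nat list"
        have dec: "v = take (i - n - k) v @ (take k (drop (i - n - k) v) @ (u v @ [v ! i]) @ take k (drop (Suc i) v)) @ drop (Suc i + k) v"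
          if "length v = m" for v
        proof -
          have a: "i - n = (i - n - k) + k" using 3 by simp
          have b: "drop (i - n) v = take n (drop (i - n) v) @ drop i v"
            using 3 by (metis append_take_drop_id drop_drop add.commute le_add_diff_inverse2 add_leD2)
          have c: "drop i v = v ! i # drop (Suc i) v" using less.prems that by (simp add: Cons_nth_drop_Suc)
          have d: "drop (i - n - k) v = take k (drop (i - n - k) v) @ drop (i - n) v"
            using a by (metis append_take_drop_id drop_drop add.commute)
          have e: "drop (Suc i) v = take k (drop (Suc i) v) @ drop (Suc i + k) v"
            by (metis append_take_drop_id drop_drop add.commute)
          have "v = take (i - n - k) v @ drop (i - n - k) v" by simp
          then show ?thesis using b c d e by (metis append.assoc append_Cons append_Nil u_def)
        qed
        have bx: "biext (u v @ [v ! i])" if v: "irr v" "length v = m" for v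
        proof (rule bi)
          have "irr (take k (drop (i - n - k) v) @ (u v @ [v ! i]) @ take k (drop (Suc i) v))"
            using dec[OF v(2)] v(1) irr_factor by metis
          moreover have "length (take k (drop (i - n - k) v)) = k" "length (take k (drop (Suc i) v)) = k"
            using 3 v(2) less.prems by auto
          ultimately show "ext k (u v @ [v ! i])" unfolding ext_def by blast
          then have "irr (u v @ [v ! i])" using ext_mono[of k _ 0] by (auto simp: ext_def)
          moreover have "length (u v @ [v ! i]) = Suc n" using 3 v(2) less.prems by (simp add: u_def)
          ultimately show "u v @ [v ! i] \<in> words (Suc n)" using irr_words by metis
        qed
        have "u w = u w'"
        proof (rule nth_equalityI)
          show "length (u w) = length (u w')" using len by (simp add: u_def)
          fix j assume "j < length (u w)"
          then have "j < n" by (simp add: u_def)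
          then show "u w ! j = u w' ! j"
            using less.IH[of "i - n + j"] less.prems 3 len by (simp add: u_def)
        qed
        moreover have "length (u w) = n" using 3 len less.prems by (simp add: u_def)
        ultimately show ?thesis using uniq bx[OF irr(1) len(1)] bx[OF irr(2) len(2)] by metis
      qed
    qed
  qed
  obtain m where m: "card {w. irr w \<and> length w = m} > (q + 1) ^ (k + n) * (q + 1) ^ k"
    using assms by blast
  have fin: "finite {l. set l \<subseteq> {..<q} \<and> length l \<le> j}" for j
    using finite_lists_length_le[of "{..<q}" j] by simp
  have card_le: "card {l. set l \<subseteq> {..<q} \<and> length l \<le> j} \<le> (q + 1) ^ j" for j
  proof -
    have "card {l. set l \<subseteq> {..<q} \<and> length l \<le> j} = (\<Sum>i\<le>j. q ^ i)"
      using card_lists_length_le[of "{..<q}" j] by simp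
    also have "\<dots> \<le> (q + 1) ^ j"
    proof (induction j)
      case (Suc j)
      have q: "q ^ Suc j \<le> q * (q + 1) ^ j" by (simp add: power_mono)
      have "(\<Sum>i\<le>Suc j. q ^ i) = q ^ Suc j + (\<Sum>i\<le>j. q ^ i)" by simp
      also have "\<dots> \<le> q * (q + 1) ^ j + (q + 1) ^ j" by (rule add_mono[OF q Suc])
      also have "\<dots> = (q + 1) ^ Suc j" by (simp add: algebra_simps)
      finally show ?case .
    qed simp
    finally show ?thesis .
  qed
  \<comment> \<open>For small \<open>m\<close> the prefix and the suffix may be shorter than
    prescribed, hence lists of bounded length are counted.\<close>
  have "card {w. irr w \<and> length w = m} \<le> card ({l. set l \<subseteq> {..<q} \<and> length l \<le> k + n} \<times> {l. set l \<subseteq> {..<q} \<and> length l \<le> k})"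
  proof (rule card_inj_on_le[of "\<lambda>w. (take (k + n) w, drop (m - k) w)"])
    show "inj_on (\<lambda>w. (take (k + n) w, drop (m - k) w)) {w. irr w \<and> length w = m}"
      using inj by (intro inj_onI) blast
    show "(\<lambda>w. (take (k + n) w, drop (m - k) w)) ` {w. irr w \<and> length w = m} \<subseteq>
        {l. set l \<subseteq> {..<q} \<and> length l \<le> k + n} \<times> {l. set l \<subseteq> {..<q} \<and> length l \<le> k}"
      by (auto simp: irr_def dest!: in_set_takeD in_set_dropD)
  qed (intro finite_cartesian_product fin)
  also have "\<dots> \<le> (q + 1) ^ (k + n) * (q + 1) ^ k"
    unfolding card_cartesian_product by (intro mult_mono card_le) auto
  finally show False using m by simp
qed

end

section \<open>Independent products of linear forms\<close>

context word_algebra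
begin

section \<open>Products of linear forms and their expansion over words\<close>

definition lin :: "(nat \<Rightarrow> 'k) \<Rightarrow> 'q" where "lin c = (\<Sum>z<q. emb (c z) * x z)"

definition lprod :: "(nat \<Rightarrow> nat \<Rightarrow> 'k) \<Rightarrow> nat \<Rightarrow> 'q" where
  "lprod a i = prod_list (map (\<lambda>s. lin (a s)) [0..<i])"

text \<open>The order is reversed so that in \<open>lprod a i * rprod b j\<close> new factors of
  either kind enter in the middle and the outer ends stay fixed.\<close>

definition rprod :: "(nat \<Rightarrow> nat \<Rightarrow> 'k) \<Rightarrow> nat \<Rightarrow> 'q" where
  "rprod b j = prod_list (map (\<lambda>s. lin (b s)) (rev [0..<j]))"

lemma lprod_0 [simp]: "lprod a 0 = 1" and lprod_Suc: "lprod a (Suc i) = lprod a i * lin (a i)"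
  and rprod_0 [simp]: "rprod b 0 = 1" and rprod_Suc: "rprod b (Suc j) = lin (b j) * rprod b j"
  by (simp_all add: lprod_def rprod_def)

lemma words_Suc: "words (Suc m) = (\<lambda>(w, z). w @ [z]) ` (words m \<times> {..<q})"
proof
  show "words (Suc m) \<subseteq> (\<lambda>(w, z). w @ [z]) ` (words m \<times> {..<q})"
  proof
    fix w assume w: "w \<in> words (Suc m)"
    then obtain u z where "w = u @ [z]" by (cases w rule: rev_cases) (auto simp: words_def)
    then show "w \<in> (\<lambda>(w, z). w @ [z]) ` (words m \<times> {..<q})"
      using w by (auto simp: words_def image_iff)
  qed
qed (auto simp: words_def)

lemma prod_list_lin:
  "prod_list (map (\<lambda>s. lin (c s)) [0..<m]) = (\<Sum>w\<in>words m. emb (\<Prod>s<m. c s (w ! s)) * ev w)"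
proof (induction m)
  case 0
  have "words 0 = {[]}" by (auto simp: words_def)
  then show ?case by (simp add: ev_def)
next
  case (Suc m)
  have inj: "inj_on (\<lambda>(w, z). w @ [z]) (words m \<times> {..<q})" by (auto simp: inj_on_def)
  have "prod_list (map (\<lambda>s. lin (c s)) [0..<Suc m])
      = (\<Sum>w\<in>words m. emb (\<Prod>s<m. c s (w ! s)) * ev w) * lin (c m)"
    using Suc by simp
  also have "\<dots> = (\<Sum>w\<in>words m. \<Sum>z<q. (emb (\<Prod>s<m. c s (w ! s)) * ev w) * (emb (c m z) * x z))"
    by (simp add: lin_def sum_product)
  also have "\<dots> = (\<Sum>w\<in>words m. \<Sum>z<q. emb (\<Prod>s<Suc m. c s ((w @ [z]) ! s)) * ev (w @ [z]))"
  proof (intro sum.cong refl)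
    fix w z assume w: "w \<in> words m"
    then have len: "length w = m" by (simp add: words_def)
    have e: "(emb p * e) * (emb d * y) = emb (p * d) * (e * y)" for p d e y
      by (simp add: emb_mult mult.assoc) (metis emb_comm mult.assoc)
    have "(\<Prod>s<Suc m. c s ((w @ [z]) ! s)) = (\<Prod>s<m. c s (w ! s)) * c m z"
      using len by (simp add: nth_append)
    then show "(emb (\<Prod>s<m. c s (w ! s)) * ev w) * (emb (c m z) * x z)
        = emb (\<Prod>s<Suc m. c s ((w @ [z]) ! s)) * ev (w @ [z])"
      unfolding e by (simp add: ev_def)
  qed
  also have "\<dots> = (\<Sum>w\<in>words (Suc m). emb (\<Prod>s<Suc m. c s (w ! s)) * ev w)"
    unfolding words_Suc sum.reindex[OF inj] by (simp add: sum.cartesian_product case_prod_unfold)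
  finally show ?case .
qed

text \<open>The form at position \<open>s\<close> of a product of length \<open>m\<close>: after
  \<open>i\<close> factors from \<open>a\<close>, the factors from \<open>b\<close> follow with
  descending index and end in \<open>b 0\<close>.\<close>

definition cf :: "nat \<Rightarrow> nat \<Rightarrow> (nat \<Rightarrow> nat \<Rightarrow> 'k) \<Rightarrow> (nat \<Rightarrow> nat \<Rightarrow> 'k) \<Rightarrow> nat \<Rightarrow> nat \<Rightarrow> 'k" where
  "cf m i a b s = (if s < i then a s else b (m - 1 - s))"

lemma lprod_rprod:
  assumes "i \<le> m"
  shows "lprod a i * rprod b (m - i) = (\<Sum>w\<in>words m. emb (\<Prod>s<m. cf m i a b s (w ! s)) * ev w)"
proof -
  have "map (\<lambda>s. lin (cf m i a b s)) [0..<m] = map (\<lambda>s. lin (a s)) [0..<i] @ map (\<lambda>s. lin (b s)) (rev [0..<m - i])"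
  proof (rule nth_equalityI)
    fix s assume "s < length (map (\<lambda>s. lin (cf m i a b s)) [0..<m])"
    then show "map (\<lambda>s. lin (cf m i a b s)) [0..<m] ! s = (map (\<lambda>s. lin (a s)) [0..<i] @ map (\<lambda>s. lin (b s)) (rev [0..<m - i])) ! s"
      using assms by (auto simp: nth_append cf_def rev_nth)
  qed (use assms in simp)
  then have "lprod a i * rprod b (m - i) = prod_list (map (\<lambda>s. lin (cf m i a b s)) [0..<m])"
    by (simp add: lprod_def rprod_def)
  then show ?thesis by (simp add: prod_list_lin)
qed

definition short :: "nat \<Rightarrow> 'q set" where "short m = ev ` {w. set w \<subseteq> {..<q} \<and> length w < m}"

text \<open>\<open>good m a b\<close>: the products \<open>a\<^sub>0 \<dots> a\<^bsub>i-1\<^esub> b\<^bsub>m-i-1\<^esub> \<dots> b\<^sub>0\<close> with \<open>0 \<le> i \<le> m\<close> are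
  independent modulo words of length less than \<open>m\<close>.\<close>

definition good :: "nat \<Rightarrow> (nat \<Rightarrow> nat \<Rightarrow> 'k) \<Rightarrow> (nat \<Rightarrow> nat \<Rightarrow> 'k) \<Rightarrow> bool" where
  "good m a b \<longleftrightarrow> (\<forall>l. (\<Sum>i<Suc m. emb (l i) * (lprod a i * rprod b (m - i))) \<in> kspan emb (short m)
      \<longrightarrow> (\<forall>i<Suc m. l i = 0))"

text \<open>Goodness is independence of the columns of a matrix whose rows are the functionals
  vanishing on \<open>short m\<close>. Along a line of coefficients its entries are polynomials in
  \<open>t\<close>, so one good parameter leaves only the roots of \<open>d\<close> as possible
  exceptions.\<close>

lemma good_cofinitely:
  fixes a0 a1 b0 b1 :: "nat \<Rightarrow> nat \<Rightarrow> 'k"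
  defines "ga t \<equiv> (\<lambda>s z. a0 s z + t * a1 s z)" and "gb t \<equiv> (\<lambda>s z. b0 s z + t * b1 s z)"
  assumes "good m (ga t0) (gb t0)"
  shows "\<exists>d. d \<noteq> 0 \<and> (\<forall>t. poly d t \<noteq> 0 \<longrightarrow> good m (ga t) (gb t))"
proof -
  define R where "R = {\<phi>. klinear emb \<phi> \<and> (\<forall>y\<in>short m. \<phi> y = 0)}"
  define N where "N \<phi> i = (\<Sum>w\<in>words m. smult (\<phi> (ev w))
     (\<Prod>s<m. [: cf m i a0 b0 s (w ! s), cf m i a1 b1 s (w ! s) :]))" for \<phi> i
  have cf: "cf m i (ga t) (gb t) s z = cf m i a0 b0 s z + t * cf m i a1 b1 s z" for i s z t
    by (simp add: cf_def ga_def gb_def)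
  have pN: "poly (N \<phi> i) t = \<phi> (lprod (ga t) i * rprod (gb t) (m - i))" if "\<phi> \<in> R" "i < Suc m" for \<phi> i t
  proof -
    have lin: "klinear emb \<phi>" using that by (simp add: R_def)
    have "i \<le> m" using that by simp
    show ?thesis
      unfolding lprod_rprod[OF \<open>i \<le> m\<close>] klinear_sum[OF lin] N_def poly_sum
      by (intro sum.cong) (auto simp: poly_prod cf)
  qed
  have pN': "(\<Sum>i<Suc m. l i * poly (N \<phi> i) t) = \<phi> (\<Sum>i<Suc m. emb (l i) * (lprod (ga t) i * rprod (gb t) (m - i)))"
    if "\<phi> \<in> R" for \<phi> l t
  proof -
    have "klinear emb \<phi>" using that by (simp add: R_def)
    then show ?thesis unfolding klinear_sum[OF \<open>klinear emb \<phi>\<close>] using pN[OF that] by (intro sum.cong) auto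
  qed
  have iff: "good m (ga t) (gb t) \<longleftrightarrow> (\<forall>l. (\<forall>\<phi>\<in>R. (\<Sum>i<Suc m. l i * poly (N \<phi> i) t) = 0) \<longrightarrow> (\<forall>i<Suc m. l i = 0))" for t
  proof -
    have "y \<in> kspan emb (short m) \<longleftrightarrow> (\<forall>\<phi>\<in>R. \<phi> y = 0)" for y
    proof
      assume "y \<in> kspan emb (short m)"
      then show "\<forall>\<phi>\<in>R. \<phi> y = 0" using klinear_zero_on_span[of _ "short m" y] by (auto simp: R_def)
    next
      assume *: "\<forall>\<phi>\<in>R. \<phi> y = 0"
      show "y \<in> kspan emb (short m)"
      proof (rule ccontr)
        assume "y \<notin> kspan emb (short m)"
        then obtain \<phi> where "klinear emb \<phi>" "\<And>x. x \<in> short m \<Longrightarrow> \<phi> x = 0" "\<phi> y = 1"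
          using separating_functional by blast
        then show False using * by (force simp: R_def)
      qed
    qed
    then show ?thesis unfolding good_def using pN' by auto
  qed
  show ?thesis
    using columns_independent_cofinitely[where R = R and n = "Suc m" and N = N and e = t0] assms(3) unfolding iff by blast
qed

lemma infinite_nonroot:
  assumes "infinite (UNIV :: 'k set)" "d \<noteq> (0 :: 'k poly)"
  obtains t where "poly d t \<noteq> 0"
proof -
  have "finite {t. poly d t = 0}" using assms(2) by (rule poly_roots_finite)
  then have "{t. poly d t = 0} \<noteq> UNIV" using assms(1) by metis
  then show ?thesis using that by blast
qed

text \<open>The coefficients of \<open>w\<close> are those in the monomial algebra when each form of
  the first kind weights \<open>z\<close> by \<alpha> and each of the second kind by 1. Two
  continuations of a right special word differ only in the last column, which forces the last
  coefficient to vanish; the other columns are seen on shorter words.\<close>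

lemma monomial_columns_independent:
  assumes "\<And>n. \<exists>u a b. length u = n \<and> a \<noteq> b \<and> biext (u @ [a]) \<and> biext (u @ [b])"
    and "inj_on \<alpha> {..<q}" "\<And>z. z < q \<Longrightarrow> \<alpha> z \<noteq> (0::'k)"
    and "\<And>w. biext w \<Longrightarrow> length w = m \<Longrightarrow> (\<Sum>i<Suc m. l i * (\<Prod>s<i. \<alpha> (w ! s))) = 0"
  shows "\<forall>i<Suc m. l i = 0"
  using assms(4)
proof (induction m)
  case 0
  obtain u a b where "length u = 0" "biext (u @ [a])" using assms(1)[of 0] by blast
  \<comment> \<open>For \<open>m = 0\<close> the only equation comes from the empty word, which is
    biextendable because a longer word is.\<close>
  have "biext []"
    unfolding biext_def
  proof
    fix k
    obtain w r where "length w = k" "length r = k" "irr (w @ (u @ [a]) @ r)"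
      using \<open>biext (u @ [a])\<close> unfolding biext_def ext_def by blast
    moreover have "w @ (u @ [a]) @ r = [] @ (w @ [] @ take k ((u @ [a]) @ r)) @ drop k ((u @ [a]) @ r)"
      by (metis append.left_neutral append.assoc append_take_drop_id)
    ultimately have "irr (w @ [] @ take k ((u @ [a]) @ r))" using irr_factor by metis
    then show "ext k []" using \<open>length w = k\<close> \<open>length r = k\<close> unfolding ext_def
      by (intro exI[of _ w] exI[of _ "take k ((u @ [a]) @ r)"]) simp
  qed
  then show ?case using 0[of "[]"] by simp
next
  case (Suc m)
  obtain u a b where u: "length u = m" "a \<noteq> b" "biext (u @ [a])" "biext (u @ [b])" using assms(1) by blast
  have irr: "irr (u @ [a])" "irr (u @ [b])" using u biext_irr by auto
  have ab: "a < q" "b < q" using irr by (auto simp: irr_def)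
  have pr: "(\<Prod>s<i. \<alpha> ((w @ [c]) ! s)) = (\<Prod>s<i. \<alpha> (w ! s))" if "i \<le> length w" for i w c
    using that by (intro prod.cong) (auto simp: nth_append)
  define P where "P = (\<Prod>s<m. \<alpha> (u ! s))"
  define S where "S = (\<Sum>i<Suc m. l i * (\<Prod>s<i. \<alpha> (u ! s)))"
  have split: "S + l (Suc m) * (P * \<alpha> c) = 0" if "c \<in> {a, b}" for c
  proof -
    have "(\<Sum>i<Suc (Suc m). l i * (\<Prod>s<i. \<alpha> ((u @ [c]) ! s))) = 0"
      using Suc.prems[of "u @ [c]"] u that by auto
    moreover have "(\<Sum>i<Suc m. l i * (\<Prod>s<i. \<alpha> ((u @ [c]) ! s))) = S"
      unfolding S_def using pr[of _ u c] u(1) by (intro sum.cong) auto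
    moreover have "(\<Prod>s<Suc m. \<alpha> ((u @ [c]) ! s)) = P * \<alpha> c"
      using pr[of m u c] u(1) by (simp add: P_def nth_append)
    ultimately show ?thesis by (simp only: sum.lessThan_Suc)
  qed
  have "P \<noteq> 0" unfolding P_def using irr(1) u(1) assms(3) by (auto simp: irr_def subset_iff)
  moreover have "l (Suc m) * (P * \<alpha> a) = l (Suc m) * (P * \<alpha> b)"
    using split[of a] split[of b] by (metis add_left_cancel insertCI)
  moreover have "\<alpha> a \<noteq> \<alpha> b" using assms(2) ab u(2) by (auto simp: inj_on_def)
  ultimately have l0: "l (Suc m) = 0" by simp
  have "\<forall>i<Suc m. l i = 0"
  proof (rule Suc.IH)
    fix w assume w: "biext w" "length w = m"
    obtain z where "biext (w @ [z])" using biext_extend[OF w(1)] by blast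
    then have "(\<Sum>i<Suc (Suc m). l i * (\<Prod>s<i. \<alpha> ((w @ [z]) ! s))) = 0" using Suc.prems w by simp
    then have "(\<Sum>i<Suc m. l i * (\<Prod>s<i. \<alpha> ((w @ [z]) ! s))) = 0" using l0 by simp
    moreover have "(\<Sum>i<Suc m. l i * (\<Prod>s<i. \<alpha> ((w @ [z]) ! s))) = (\<Sum>i<Suc m. l i * (\<Prod>s<i. \<alpha> (w ! s)))"
      using pr[of _ w z] w(2) by (intro sum.cong) auto
    ultimately show "(\<Sum>i<Suc m. l i * (\<Prod>s<i. \<alpha> (w ! s))) = 0" by simp
  qed
  then show ?case using l0 by (simp add: less_Suc_eq)
qed

text \<open>The coefficient of a word is weighted by \<open>t\<close> to the value of the word in base \<open>q\<close>. As
  \<open>t\<close> tends to \<open>0\<close> this degenerates the algebra to the monomial algebra of the irreducible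
  words, so that the monomial case gives independence for almost all \<open>t\<close>.\<close>

lemma good_exists:
  assumes inf: "infinite (UNIV :: 'k set)"
    and rs: "\<And>n. \<exists>u a b. length u = n \<and> a \<noteq> b \<and> biext (u @ [a]) \<and> biext (u @ [b])"
  shows "\<exists>a b. good m a b"
proof -
  obtain A where A: "finite A" "card A = q" "A \<subseteq> UNIV - {0 :: 'k}"
    using infinite_arbitrarily_large[of "UNIV - {0 :: 'k}" q] inf by auto
  then obtain \<alpha> where "bij_betw \<alpha> {..<q} A" using ex_bij_betw_nat_finite[of A] by (auto simp: atLeast0LessThan)
  then have \<alpha>: "inj_on \<alpha> {..<q}" "\<And>z. z < q \<Longrightarrow> \<alpha> z \<noteq> 0" using A(3) by (auto simp: bij_betw_def)
  define R where "R = {w. biext w \<and> length w = m}"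
  have "\<forall>w. \<exists>\<phi>. w \<in> R \<longrightarrow> klinear emb \<phi> \<and> (\<forall>y\<in>ev ` below w. \<phi> y = 0) \<and> \<phi> (ev w) = 1"
  proof
    fix w
    show "\<exists>\<phi>. w \<in> R \<longrightarrow> klinear emb \<phi> \<and> (\<forall>y\<in>ev ` below w. \<phi> y = 0) \<and> \<phi> (ev w) = 1"
    proof (cases "w \<in> R")
      case True
      then have "ev w \<notin> kspan emb (ev ` below w)" using biext_irr by (auto simp: R_def irr_def)
      then show ?thesis by (rule separating_functional) blast
    qed auto
  qed
  then obtain \<phi> where \<phi>: "\<And>w. w \<in> R \<Longrightarrow> klinear emb (\<phi> w)"
    "\<And>w v. w \<in> R \<Longrightarrow> v \<in> below w \<Longrightarrow> \<phi> w (ev v) = 0" "\<And>w. w \<in> R \<Longrightarrow> \<phi> w (ev w) = 1" by (metis image_eqI)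
  have Rw: "w \<in> words m" if "w \<in> R" for w using that biext_irr irr_words by (auto simp: R_def)
  define \<kappa> where "\<kappa> i w = (\<Prod>s<i. \<alpha> (w ! s))" for i w
  define N where "N w i = (\<Sum>v\<in>{v\<in>words m. val w \<le> val v}. monom (\<kappa> i v * \<phi> w (ev v)) (val v - val w))" for w i
  have N0: "poly (N w i) 0 = \<kappa> i w" if "w \<in> R" for w i
  proof -
    have "poly (N w i) 0 = (\<Sum>v\<in>{v\<in>words m. val w \<le> val v}. if v = w then \<kappa> i w else 0)"
      unfolding N_def poly_sum
    proof (intro sum.cong refl)
      fix v assume v: "v \<in> {v \<in> words m. val w \<le> val v}"
      show "poly (monom (\<kappa> i v * \<phi> w (ev v)) (val v - val w)) 0 = (if v = w then \<kappa> i w else 0)"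
      proof (cases "v = w")
        case True
        then show ?thesis using \<phi>(3)[OF that] by (simp add: poly_monom)
      next
        case False
        then have "val v \<noteq> val w" using v Rw[OF that] val_inj by auto
        then show ?thesis using v False by (simp add: poly_monom)
      qed
    qed
    also have "\<dots> = \<kappa> i w" using Rw[OF that] by simp
    finally show ?thesis .
  qed
  have ind: "\<forall>i<Suc m. l i = 0" if "\<forall>w\<in>R. (\<Sum>i<Suc m. l i * poly (N w i) 0) = 0" for l
  proof (rule monomial_columns_independent[OF rs \<alpha>])
    fix w assume w: "biext w" "length w = m"
    show "(\<Sum>i<Suc m. l i * (\<Prod>s<i. \<alpha> (w ! s))) = 0"
    proof -
      have "w \<in> R" using w by (simp add: R_def)
      then have "(\<Sum>i<Suc m. l i * poly (N w i) 0) = 0" using that by blast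
      then show ?thesis unfolding N0[OF \<open>w \<in> R\<close>] \<kappa>_def .
    qed
  qed
  obtain d where d: "d \<noteq> 0" "\<And>t l. poly d t \<noteq> 0 \<Longrightarrow> (\<forall>w\<in>R. (\<Sum>i<Suc m. l i * poly (N w i) t) = 0) \<Longrightarrow> (\<forall>i<Suc m. l i = 0)"
    using columns_independent_cofinitely[where R = R and n = "Suc m" and N = N and e = 0, OF ind] by blast
  \<comment> \<open>The factor \<open>[:0, 1:]\<close> makes \<open>t\<close> nonzero, so that
    \<open>t ^ val w\<close> can be cancelled.\<close>
  obtain t where "poly (d * [:0, 1:]) t \<noteq> 0" using infinite_nonroot[OF inf, of "d * [:0, 1:]"] d(1) by auto
  then have t: "poly d t \<noteq> 0" "t \<noteq> 0" by auto
  define a where "a s z = \<alpha> z * t ^ (z * q ^ (m - 1 - s))" for s z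
  define b where "b s z = t ^ (z * q ^ s)" for s z
  have coef: "(\<Prod>s<m. cf m i a b s (v ! s)) = \<kappa> i v * t ^ val v" if "v \<in> words m" "i \<le> m" for i v
  proof -
    have "(\<Prod>s<m. cf m i a b s (v ! s)) = (\<Prod>s<m. (if s < i then \<alpha> (v ! s) else 1) * t ^ (v ! s * q ^ (m - 1 - s)))"
      by (intro prod.cong) (auto simp: cf_def a_def b_def)
    also have "\<dots> = (\<Prod>s<m. if s < i then \<alpha> (v ! s) else 1) * (\<Prod>s<m. t ^ (v ! s * q ^ (m - 1 - s)))"
      by (simp add: prod.distrib)
    also have "(\<Prod>s<m. if s < i then \<alpha> (v ! s) else 1) = \<kappa> i v"
    proof -
      have "{..<m} \<inter> {s. s < i} = {..<i}" using that(2) by auto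
      then show ?thesis by (simp add: prod.If_cases \<kappa>_def)
    qed
    also have "(\<Prod>s<m. t ^ (v ! s * q ^ (m - 1 - s))) = t ^ val v"
      using that(1) by (simp add: power_sum val_nth words_def)
    finally show ?thesis .
  qed
  have key: "\<phi> w (lprod a i * rprod b (m - i)) = t ^ val w * poly (N w i) t" if "w \<in> R" "i < Suc m" for w i
  proof -
    have "\<phi> w (lprod a i * rprod b (m - i)) = (\<Sum>v\<in>words m. (\<Prod>s<m. cf m i a b s (v ! s)) * \<phi> w (ev v))"
      using that by (simp add: lprod_rprod klinear_sum[OF \<phi>(1)])
    also have "\<dots> = (\<Sum>v\<in>words m. \<kappa> i v * t ^ val v * \<phi> w (ev v))"
      using that by (intro sum.cong) (auto simp: coef)
    also have "\<dots> = (\<Sum>v\<in>{v\<in>words m. val w \<le> val v}. \<kappa> i v * t ^ val v * \<phi> w (ev v))"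
    proof (intro sum.mono_neutral_right ballI)
      fix v assume "v \<in> words m - {v \<in> words m. val w \<le> val v}"
      then have "v \<in> below w" using Rw[OF that(1)] by (auto simp: below_def words_def)
      then show "\<kappa> i v * t ^ val v * \<phi> w (ev v) = 0" using \<phi>(2)[OF that(1)] by simp
    qed auto
    also have "\<dots> = t ^ val w * poly (N w i) t"
      unfolding N_def poly_sum sum_distrib_left
    proof (intro sum.cong refl)
      fix v assume v: "v \<in> {v \<in> words m. val w \<le> val v}"
      have "t ^ val v = t ^ val w * t ^ (val v - val w)" using v by (simp add: power_add[symmetric])
      then show "\<kappa> i v * t ^ val v * \<phi> w (ev v) = t ^ val w * poly (monom (\<kappa> i v * \<phi> w (ev v)) (val v - val w)) t"
        by (simp add: poly_monom mult_ac)
    qed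
    finally show ?thesis .
  qed
  have "good m a b"
    unfolding good_def
  proof (intro allI impI, rule d(2)[rule_format, OF t(1)])
    fix l i w assume l: "(\<Sum>i<Suc m. emb (l i) * (lprod a i * rprod b (m - i))) \<in> kspan emb (short m)"
      and w: "w \<in> R"
    have "\<phi> w y = 0" if "y \<in> short m" for y
      using that \<phi>(2)[OF w] Rw[OF w] by (auto simp: short_def below_def words_def)
    then have "\<phi> w (\<Sum>i<Suc m. emb (l i) * (lprod a i * rprod b (m - i))) = 0"
      using klinear_zero_on_span[OF \<phi>(1)[OF w]] l by blast
    moreover have "\<phi> w (\<Sum>i<Suc m. emb (l i) * (lprod a i * rprod b (m - i)))
        = (\<Sum>i<Suc m. l i * (t ^ val w * poly (N w i) t))"
      unfolding klinear_sum[OF \<phi>(1)[OF w]] using key[OF w] by (intro sum.cong) auto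
    ultimately have "(\<Sum>i<Suc m. l i * (t ^ val w * poly (N w i) t)) = 0" by simp
    then have "t ^ val w * (\<Sum>i<Suc m. l i * poly (N w i) t) = 0"
      by (simp add: sum_distrib_left mult_ac del: sum.lessThan_Suc)
    then show "(\<Sum>i<Suc m. l i * poly (N w i) t) = 0" using t(2) by simp
  qed
  then show ?thesis by blast
qed

text \<open>A line joins coefficients good up to \<open>M\<close> to coefficients good in degree
  \<open>M + 1\<close>. Each degree excludes finitely many parameters, and an infinite field has one
  outside all of them.\<close>

lemma good_exists_upto:
  assumes inf: "infinite (UNIV :: 'k set)"
    and rs: "\<And>n. \<exists>u a b. length u = n \<and> a \<noteq> b \<and> biext (u @ [a]) \<and> biext (u @ [b])"
  shows "\<exists>a b. \<forall>m\<le>M. good m a b"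
proof (induction M)
  case 0
  then show ?case using good_exists[OF assms, of 0] by auto
next
  case (Suc M)
  then obtain a0 b0 where ab0: "\<forall>m\<le>M. good m a0 b0" by blast
  obtain a1 b1 where ab1: "good (Suc M) a1 b1" using good_exists[OF assms] by blast
  define ga where "ga t = (\<lambda>s z. a0 s z + t * (a1 s z - a0 s z))" for t
  define gb where "gb t = (\<lambda>s z. b0 s z + t * (b1 s z - b0 s z))" for t
  have "\<exists>d. d \<noteq> 0 \<and> (\<forall>t. poly d t \<noteq> 0 \<longrightarrow> good m (ga t) (gb t))" if "m \<le> Suc M" for m
  proof -
    define t0 :: 'k where "t0 = (if m \<le> M then 0 else 1)"
    have "good m (ga t0) (gb t0)"
      using ab0 ab1 that by (cases "m \<le> M") (auto simp: t0_def ga_def gb_def le_Suc_eq)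
    then show ?thesis
      using good_cofinitely[of m a0 t0 "\<lambda>s z. a1 s z - a0 s z" b0 "\<lambda>s z. b1 s z - b0 s z"]
      unfolding ga_def gb_def by blast
  qed
  then obtain d where d: "\<And>m. m \<le> Suc M \<Longrightarrow> d m \<noteq> 0 \<and> (\<forall>t. poly (d m) t \<noteq> 0 \<longrightarrow> good m (ga t) (gb t))"
    by metis
  have "(\<Prod>m\<le>Suc M. d m) \<noteq> 0" using d by simp
  then obtain t where "poly (\<Prod>m\<le>Suc M. d m) t \<noteq> 0" using infinite_nonroot[OF inf] by blast
  then have "\<forall>m\<le>Suc M. poly (d m) t \<noteq> 0" by (simp add: poly_prod del: prod.atMost_Suc)
  then show ?case using d by blast
qed

text \<open>Superlinear growth gives right special words and hence forms that are good in all
  degrees up to \<open>2 * L\<close>, the largest degree of a product in the square. In a relation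
  the part of top degree lies in the span of shorter words, so goodness makes its coefficients
  vanish.\<close>

theorem independent_products:
  assumes inf: "infinite (UNIV :: 'k set)"
    and growth: "\<And>c. \<exists>n T. finite T \<and> (\<forall>w\<in>T. set w \<subseteq> {..<q} \<and> length w \<le> n) \<and> c * (n + 1) < card T \<and> kindep emb T ev"
  shows "\<exists>a b. kindep emb ({..L} \<times> {..L}) (\<lambda>(i, j). lprod a i * rprod b j)"
proof -
  have unb: "\<exists>m. card {w. irr w \<and> length w = m} > M" for M
  proof (rule ccontr)
    assume "\<not> ?thesis"
    then have b: "card {w. irr w \<and> length w = m} \<le> M" for m by (meson not_less)
    obtain n T where "finite T" "\<forall>w\<in>T. set w \<subseteq> {..<q} \<and> length w \<le> n" "M * (n + 1) < card T" "kindep emb T ev"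
      using growth[of M] by metis
    then show False using irr_count_bound[OF b, of T n] by auto
  qed
  obtain a b where ab: "\<And>m. m \<le> 2 * L \<Longrightarrow> good m a b"
    using good_exists_upto[OF inf right_special[OF unb], of "2 * L"] by blast
  let ?v = "\<lambda>(i, j). lprod a i * rprod b j"
  have "kindep emb ({..L} \<times> {..L}) ?v"
    unfolding kindep_def
  proof (intro allI impI, rule ccontr)
    fix l assume s0: "(\<Sum>p\<in>{..L} \<times> {..L}. emb (l p) * ?v p) = 0" and "\<not> (\<forall>p\<in>{..L} \<times> {..L}. l p = 0)"
    then obtain p0 where p0: "p0 \<in> {..L} \<times> {..L}" "l p0 \<noteq> 0" by blast
    define Z where "Z = {p \<in> {..L} \<times> {..L}. l p \<noteq> 0}"
    have Z: "finite Z" "Z \<noteq> {}" using p0 by (auto simp: Z_def)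
    define m where "m = Max ((\<lambda>(i, j). i + j) ` Z)"
    have mZ: "m \<in> (\<lambda>(i, j). i + j) ` Z" unfolding m_def using Z by (intro Max_in) auto
    then obtain i0 j0 where ij: "i0 \<le> L" "j0 \<le> L" "l (i0, j0) \<noteq> 0" "m = i0 + j0" by (auto simp: Z_def)
    have big: "l (i, j) = 0" if "i \<le> L" "j \<le> L" "i + j > m" for i j
    proof (rule ccontr)
      assume "l (i, j) \<noteq> 0"
      then have "i + j \<in> (\<lambda>(i, j). i + j) ` Z" using that by (force simp: Z_def)
      then have "i + j \<le> m" unfolding m_def using Z by (intro Max_ge) auto
      then show False using that by simp
    qed
    define l' where "l' i = (if i \<le> L \<and> m - i \<le> L then l (i, m - i) else 0)" for i
    define E where "E = {p \<in> {..L} \<times> {..L}. fst p + snd p = m}"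
    define F where "F = {p \<in> {..L} \<times> {..L}. fst p + snd p < m}"
    have "(\<Sum>p\<in>{..L} \<times> {..L}. emb (l p) * ?v p) = (\<Sum>p\<in>E \<union> F. emb (l p) * ?v p)"
    proof (rule sum.mono_neutral_right)
      show "\<forall>p\<in>{..L} \<times> {..L} - (E \<union> F). emb (l p) * ?v p = 0"
      proof
        fix p assume p: "p \<in> {..L} \<times> {..L} - (E \<union> F)"
        obtain i j where "p = (i, j)" by (cases p)
        moreover have "i \<le> L" "j \<le> L" "i + j > m" using p \<open>p = (i, j)\<close> by (auto simp: E_def F_def)
        ultimately have "l p = 0" using big[of i j] by simp
        then show "emb (l p) * ?v p = 0" by simp
      qed
    qed (auto simp: E_def F_def)
    also have "\<dots> = (\<Sum>p\<in>E. emb (l p) * ?v p) + (\<Sum>p\<in>F. emb (l p) * ?v p)"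
      by (rule sum.union_disjoint) (auto simp: E_def F_def)
    finally have EF: "(\<Sum>p\<in>E. emb (l p) * ?v p) = - (\<Sum>p\<in>F. emb (l p) * ?v p)"
      using s0 by (simp add: eq_neg_iff_add_eq_0)
    have Einj: "inj_on (\<lambda>i. (i, m - i)) {i. i \<le> L \<and> m - i \<le> L \<and> i \<le> m}" by (auto simp: inj_on_def)
    have Eim: "E = (\<lambda>i. (i, m - i)) ` {i. i \<le> L \<and> m - i \<le> L \<and> i \<le> m}" by (force simp: E_def)
    have "(\<Sum>i<Suc m. emb (l' i) * (lprod a i * rprod b (m - i)))
        = (\<Sum>i\<in>{i. i \<le> L \<and> m - i \<le> L \<and> i \<le> m}. emb (l (i, m - i)) * (lprod a i * rprod b (m - i)))"
      by (rule sum.mono_neutral_cong_right) (auto simp: l'_def)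
    also have "\<dots> = (\<Sum>p\<in>E. emb (l p) * ?v p)" unfolding Eim sum.reindex[OF Einj] by simp
    also have "\<dots> = - (\<Sum>p\<in>F. emb (l p) * ?v p)" by (rule EF)
    also have "\<dots> \<in> kspan emb (short m)"
      unfolding kspan_eq
    proof (intro vs.span_neg vs.span_sum)
      fix p assume p: "p \<in> F"
      obtain i j where pij: "p = (i, j)" by (cases p)
      have "lprod a i * rprod b (i + j - i) \<in> vs.span (short m)"
        unfolding lprod_rprod[OF le_add1]
      proof (rule vs.span_sum)
        fix w assume "w \<in> words (i + j)"
        then have "ev w \<in> short m" using p pij by (auto simp: short_def words_def F_def)
        then show "emb (\<Prod>s<i + j. cf (i + j) i a b s (w ! s)) * ev w \<in> vs.span (short m)"
          using vs.span_scale[OF vs.span_base, of "ev w" "short m"] by (simp add: scl_def)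
      qed
      then show "emb (l p) * ?v p \<in> vs.span (short m)"
        using vs.span_scale[of _ "short m" "l p"] by (simp add: pij scl_def)
    qed
    finally have "\<forall>i<Suc m. l' i = 0" using ab[of m] ij unfolding good_def by auto
    then have "l' i0 = 0" using ij by simp
    then show False using ij by (simp add: l'_def)
  qed
  then show ?thesis by blast
qed

end

section \<open>Filtrations of subcubic growth\<close>

context central_algebra
begin

text \<open>Each of the \<open>L\<close> conditions \<open>T (Suc j) u \<in> V\<close> costs only the codimension of \<open>V\<close> in \<open>H\<close>, because
  the previous condition already puts \<open>T (Suc j) u\<close> into \<open>H\<close>.\<close>

lemma inner_element:
  fixes T :: "nat \<Rightarrow> 'q \<Rightarrow> 'q"
  assumes "\<And>u. T 0 u = u" "\<And>j \<phi>. klinear emb \<phi> \<Longrightarrow> klinear emb (\<lambda>u. \<phi> (T j u))"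
    and "ksubspace emb V" "finite F" "H \<subseteq> kspan emb F" "V \<subseteq> H"
    and "\<And>j u. T j u \<in> V \<Longrightarrow> T (Suc j) u \<in> H"
    and "L * (kdim emb H - kdim emb V) < kdim emb V"
  obtains u where "u \<in> V" "u \<noteq> 0" "\<And>j. j \<le> L \<Longrightarrow> T j u \<in> V"
proof -
  obtain \<Psi> where \<Psi>: "finite \<Psi>" "card \<Psi> + kdim emb V = kdim emb H" "\<And>\<psi>. \<psi> \<in> \<Psi> \<Longrightarrow> klinear emb \<psi>"
    "\<And>h. h \<in> H \<Longrightarrow> (\<And>\<psi>. \<psi> \<in> \<Psi> \<Longrightarrow> \<psi> h = 0) \<Longrightarrow> h \<in> V"
    using codimension_functionals[OF assms(4,5,6,3)] by blast
  define \<Phi> where "\<Phi> = (\<lambda>(j, \<psi>) u. \<psi> (T (Suc j) u)) ` ({..<L} \<times> \<Psi>)"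
  have "finite \<Phi>" using \<Psi>(1) by (simp add: \<Phi>_def)
  moreover have "card \<Phi> \<le> L * card \<Psi>"
    unfolding \<Phi>_def using card_image_le[of "{..<L} \<times> \<Psi>"] \<Psi>(1) by (simp add: card_cartesian_product)
  moreover have "card \<Psi> = kdim emb H - kdim emb V" using \<Psi>(2) by simp
  moreover have "\<And>\<phi>. \<phi> \<in> \<Phi> \<Longrightarrow> klinear emb \<phi>" using assms(2) \<Psi>(3) by (auto simp: \<Phi>_def)
  ultimately obtain u where u: "u \<in> V" "u \<noteq> 0" "\<And>\<phi>. \<phi> \<in> \<Phi> \<Longrightarrow> \<phi> u = 0"
    using common_zero[of \<Phi> V F] assms(3,4,5,6,8) by (metis le_less_trans order_trans)
  have "T j u \<in> V" if "j \<le> L" for j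
    using that
  proof (induction j)
    case (Suc j)
    show ?case
    proof (rule \<Psi>(4))
      show "T (Suc j) u \<in> H" using Suc assms(7) by simp
      fix \<psi> assume "\<psi> \<in> \<Psi>"
      then have "(\<lambda>u. \<psi> (T (Suc j) u)) \<in> \<Phi>" using Suc.prems by (force simp: \<Phi>_def)
      then show "\<psi> (T (Suc j) u) = 0" using u(3) by blast
    qed
  qed (use u assms(1) in simp)
  then show ?thesis using that u by blast
qed

text \<open>Applied with \<open>g\<close> a multiplication by the inverse of a denominator: the
  elements that the denominator carries into \<open>U\<close> form a space no larger than
  \<open>U\<close>.\<close>

lemma preimage_bound:
  assumes "finite F" "U \<subseteq> kspan emb F" and g: "\<And>c y. g (emb c * y) = emb c * g y" "\<And>y z. g (y + z) = g y + g z"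
    and "\<And>h. h \<in> H \<Longrightarrow> \<exists>y\<in>U. h = g y"
  shows "\<exists>B. finite B \<and> H \<subseteq> kspan emb B \<and> kdim emb H \<le> kdim emb U"
proof -
  obtain B where B: "B \<subseteq> U" "finite B" "U \<subseteq> kspan emb B" "card B = kdim emb U"
    using finite_basis[OF assms(1,2)] by metis
  have g0: "g 0 = 0" using g(2)[of 0 0] by simp
  have sub: "H \<subseteq> kspan emb (g ` B)"
  proof
    fix h assume "h \<in> H"
    then obtain y where y: "y \<in> U" "h = g y" using assms(5) by blast
    have "y \<in> vs.span B" using y B(3) by (auto simp: kspan_eq)
    then have "g y \<in> vs.span (g ` B)"
    proof (induction rule: vs.span_induct)
      case base
      show ?case unfolding vs.subspace_def
        using g g0 by (auto simp: scl_def[symmetric] vs.span_zero intro: vs.span_add vs.span_scale)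
    qed (auto intro: vs.span_base)
    then show "h \<in> kspan emb (g ` B)" using y by (simp add: kspan_eq)
  qed
  have "kdim emb H \<le> card (g ` B)" using vs.dim_le_card[of H "g ` B"] sub B(2) by (auto simp: kspan_eq kdim_eq)
  also have "\<dots> \<le> kdim emb U" using card_image_le[OF B(2), of g] B(4) by simp
  finally show ?thesis using sub B(2) by blast
qed

end

text \<open>If every large \<open>N\<close> failed, then \<open>f (N + p)\<close> would be at least
  \<open>f N\<close> times \<open>(1 + p / N) ^ 4\<close>. Along an arithmetic progression this
  multiplies up to quartic growth, against the subcubic bound.\<close>

lemma slow_growth_scale:
  fixes f :: "nat \<Rightarrow> nat"
  assumes pos: "\<And>n. f n \<ge> 1" and small: "\<And>c. c > 0 \<Longrightarrow> \<exists>M. \<forall>n\<ge>M. real (f n) < c * real n ^ 3" and p: "p \<ge> 1"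
  shows "\<exists>N\<ge>N0. (N div (16 * p)) * (f (N + p) - f N) < f N"
proof (rule ccontr)
  assume "\<not> ?thesis"
  then have H: "f N \<le> (N div (16 * p)) * (f (N + p) - f N)" if "N \<ge> N0" for N using that by (meson not_less)
  define N1 where "N1 = max N0 (16 * p)"
  have N1: "N1 \<ge> N0" "N1 \<ge> 16 * p" "N1 > 0" using p by (auto simp: N1_def)
  have step: "real (f (N + p)) \<ge> real (f N) * ((real N + real p) / real N) ^ 4" if "N \<ge> N1" for N
  proof -
    have N: "N \<ge> N0" "N \<ge> 16 * p" "N > 0" using that N1 by auto
    \<comment> \<open>The subtraction is truncated; positivity of \<open>f N\<close> rules out the
      value 0.\<close>
    have "f (N + p) > f N" using H[OF N(1)] pos[of N] by (metis diff_is_0_eq' mult_is_0 not_less not_one_le_zero le_trans)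
    have "real (f N) \<le> real ((N div (16 * p)) * (f (N + p) - f N))"
      using H[OF N(1)] by (simp only: of_nat_le_iff)
    also have "\<dots> = real (N div (16 * p)) * (real (f (N + p)) - real (f N))"
      using \<open>f (N + p) > f N\<close> by (simp add: of_nat_diff)
    also have "\<dots> \<le> (real N / (16 * real p)) * (real (f (N + p)) - real (f N))"
    proof (rule mult_right_mono)
      show "real (N div (16 * p)) \<le> real N / (16 * real p)"
        using of_nat_div_le_of_nat[of N "16 * p", where ?'a = real] by simp
    qed (use \<open>f (N + p) > f N\<close> in simp)
    finally have "real (f N) * (16 * real p / real N) \<le> real (f (N + p)) - real (f N)"
      using N p by (simp add: field_simps)
    then have 1: "real (f N) * (1 + 16 * (real p / real N)) \<le> real (f (N + p))" by (simp add: algebra_simps)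
    define y where "y = real p / real N"
    have y: "0 \<le> y" "y \<le> 1" using N by (auto simp: y_def)
    \<comment> \<open>The source of the constant 16: for y between 0 and 1 the nonconstant terms of
      the fourth power sum to at most (4 + 6 + 4 + 1) y.\<close>
    have "y ^ 2 \<le> y" "y ^ 3 \<le> y" "y ^ 4 \<le> y" using y power_decreasing[of 1 _ y] by auto
    moreover have "(1 + y) ^ 4 = 1 + 4 * y + 6 * y ^ 2 + 4 * y ^ 3 + y ^ 4" by algebra
    ultimately have "(1 + y) ^ 4 \<le> 1 + 16 * y" using y by linarith
    moreover have "(real N + real p) / real N = 1 + y" using N by (simp add: y_def field_simps)
    ultimately have "real (f N) * ((real N + real p) / real N) ^ 4 \<le> real (f N) * (1 + 16 * y)"
      by (simp add: mult_left_mono)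
    then show ?thesis using 1 by (simp add: y_def)
  qed
  have lower: "real (f (N1 + k * p)) \<ge> (real (N1 + k * p) / real N1) ^ 4" for k
  proof (induction k)
    case 0
    then show ?case using pos[of N1] N1 by simp
  next
    case (Suc k)
    let ?n = "N1 + k * p"
    have n: "?n > 0" using N1 by simp
    have "(real (N1 + Suc k * p) / real N1) ^ 4 = (real ?n / real N1) ^ 4 * ((real ?n + real p) / real ?n) ^ 4"
    proof -
      have "real (N1 + Suc k * p) = real ?n + real p" by simp
      moreover have "a / c = (b / c) * (a / b)" if "b \<noteq> 0" for a b c :: real using that by simp
      ultimately have "real (N1 + Suc k * p) / real N1 = (real ?n / real N1) * ((real ?n + real p) / real ?n)"
        using n by (metis of_nat_0_eq_iff less_numeral_extra(3))
      then show ?thesis by (simp only: power_mult_distrib)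
    qed
    also have "\<dots> \<le> real (f ?n) * ((real ?n + real p) / real ?n) ^ 4"
      by (rule mult_right_mono[OF Suc]) simp
    also have "\<dots> \<le> real (f (?n + p))" by (rule step) simp
    finally show ?case by (simp add: algebra_simps)
  qed
  obtain M where M: "\<And>n. n \<ge> M \<Longrightarrow> real (f n) < (1 / real N1 ^ 4) * real n ^ 3"
    using small[of "1 / real N1 ^ 4"] N1 by auto
  define n where "n = N1 + M * p"
  have "n \<ge> M" using p by (simp add: n_def trans_le_add2)
  then have "(real n / real N1) ^ 4 < (1 / real N1 ^ 4) * real n ^ 3"
    using M[of n] lower[of M] by (simp add: n_def)
  then have "real n ^ 4 < real n ^ 3" using N1 by (simp add: field_simps)
  moreover have "1 \<le> n" using N1 by (simp add: n_def)
  then have "real n ^ 3 \<le> real n ^ 4" by (intro power_increasing) auto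
  ultimately show False by simp
qed

section \<open>The dimension count over an infinite field\<close>

context word_algebra
begin

text \<open>Here \<open>s\<close> and \<open>r\<close> are common denominators of the letters on the
  left and on the right. They keep the cost of multiplying by a form down to one step of the
  filtration, and at a slow scale \<open>N\<close> about \<open>N / (16 * P)\<close> such steps are
  affordable.\<close>

theorem slow_filtration_contradiction:
  fixes U :: "nat \<Rightarrow> 'q set"
  assumes inf: "infinite (UNIV :: 'k set)"
    and sub: "\<And>n. ksubspace emb (U n)" and fin: "\<And>n. \<exists>F. finite F \<and> U n \<subseteq> kspan emb F"
    and one: "1 \<in> U 0" and mono: "\<And>n. U n \<subseteq> U (Suc n)"
    and mult: "\<And>m n y z. y \<in> U m \<Longrightarrow> z \<in> U n \<Longrightarrow> y * z \<in> U (m + n)"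
    and small: "\<And>c. c > 0 \<Longrightarrow> \<exists>M. \<forall>n\<ge>M. real (kdim emb (U n)) < c * real n ^ 3"
    and D: "ksubalg emb D" "\<And>z. z < q \<Longrightarrow> x z \<in> D"
    and left: "s \<noteq> 0" "s \<in> U p" "\<And>z. z < q \<Longrightarrow> s * x z \<in> U p"
    and right: "r \<noteq> 0" "r \<in> U p" "\<And>z. z < q \<Longrightarrow> x z * r \<in> U p"
    and indep: "\<And>u n. u \<noteq> 0 \<Longrightarrow> \<exists>b. (\<forall>k\<le>n. b k \<in> U n) \<and>
       (\<forall>d. (\<forall>k\<le>n. d k \<in> D) \<longrightarrow> (\<Sum>k\<le>n. d k * (u * b k)) = 0 \<longrightarrow> (\<forall>k\<le>n. d k = 0))"
    and growth: "\<And>c. \<exists>n T. finite T \<and> (\<forall>w\<in>T. set w \<subseteq> {..<q} \<and> length w \<le> n) \<and> c * (n + 1) < card T \<and> kindep emb T ev"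
  shows False
proof -
  have monoU: "U m \<subseteq> U n" if "m \<le> n" for m n using that mono by (rule lift_Suc_mono_le[rotated])
  define f where "f n = kdim emb (U n)" for n
  \<comment> \<open>The successor keeps the divisor \<open>16 * P\<close> positive even for
    \<open>p = 0\<close>.\<close>
  define P where "P = Suc p"
  have UP: "U p \<subseteq> U P" unfolding P_def by (rule mono)
  have subv: "vs.subspace (U n)" for n using sub by (simp add: ksubspace_eq)
  have f1: "f n \<ge> 1" for n
  proof -
    obtain F where "finite F" "U n \<subseteq> kspan emb F" using fin by blast
    then show ?thesis unfolding f_def using one monoU[of 0 n] by (intro kdim_ge_1) auto
  qed
  have P1: "P \<ge> 1" by (simp add: P_def)
  \<comment> \<open>The factor 27 absorbs the cube of \<open>3 * N\<close>, and
    \<open>256 * P ^ 2\<close> the square of \<open>16 * P\<close> coming from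
    \<open>L\<close>.\<close>
  define c where "c = 1 / (27 * 256 * real P ^ 2)"
  have "c > 0" using P1 by (simp add: c_def)
  then obtain M where M: "\<And>n. n \<ge> M \<Longrightarrow> real (f n) < c * real n ^ 3" using small unfolding f_def by blast
  obtain N where N: "N \<ge> max M 1" "(N div (16 * P)) * (f (N + P) - f N) < f N"
    using slow_growth_scale[of f P "max M 1", OF f1 _ P1] small unfolding f_def by blast
  define L where "L = N div (16 * P)"
  have LN: "L * (f (N + P) - f N) < f N" using N by (simp add: L_def)
  obtain a b where ab: "kindep emb ({..L} \<times> {..L}) (\<lambda>(i, j). lprod a i * rprod b j)"
    using independent_products[OF inf growth] by blast
  have slin: "s * lin g \<in> U P" for g
  proof -
    have "s * lin g = (\<Sum>z<q. scl emb (g z) (s * x z))"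
      by (simp add: lin_def sum_distrib_left scl_def emb_left_comm)
    also have "\<dots> \<in> U P" using left(3) UP by (intro vs.subspace_sum[OF subv] vs.subspace_scale[OF subv]) auto
    finally show ?thesis .
  qed
  have rlin: "lin g * r \<in> U P" for g
  proof -
    have "lin g * r = (\<Sum>z<q. scl emb (g z) (x z * r))"
      by (simp add: lin_def sum_distrib_right scl_def mult.assoc)
    also have "\<dots> \<in> U P" using right(3) UP by (intro vs.subspace_sum[OF subv] vs.subspace_scale[OF subv]) auto
    finally show ?thesis .
  qed
  obtain F where F: "finite F" "U (N + P) \<subseteq> kspan emb F" using fin by blast
  obtain u1 where u1: "u1 \<in> U N" "u1 \<noteq> 0" "\<And>j. j \<le> L \<Longrightarrow> rprod b j * u1 \<in> U N"
  proof -
    \<comment> \<open>Multiplying an element of \<open>U N\<close> by a form on the left lands in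
      \<open>H\<close>, since \<open>s\<close> times the form lies in \<open>U P\<close>. Dividing
      by \<open>s\<close> shows that \<open>H\<close> is no larger than
      \<open>U (N + P)\<close>.\<close>
    define H where "H = {h. s * h \<in> U (N + P)}"
    obtain B where B: "finite B" "H \<subseteq> kspan emb B" "kdim emb H \<le> f (N + P)"
    proof -
      have "\<exists>B. finite B \<and> H \<subseteq> kspan emb B \<and> kdim emb H \<le> kdim emb (U (N + P))"
      proof (rule preimage_bound[OF F, of "\<lambda>y. inverse s * y"])
        fix h assume "h \<in> H"
        then show "\<exists>y\<in>U (N + P). h = inverse s * y"
          using left(1) by (intro bexI[of _ "s * h"]) (auto simp: H_def mult.assoc[symmetric])
      qed (auto simp: emb_left_comm algebra_simps)
      then show ?thesis using that by (auto simp: f_def)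
    qed
    show ?thesis
    proof (rule inner_element[of "\<lambda>j u. rprod b j * u" "U N" B H L])
      show "U N \<subseteq> H" using mult[of s P _ N] left(2) UP by (auto simp: H_def add.commute)
      show "rprod b (Suc j) * u \<in> H" if "rprod b j * u \<in> U N" for j u
        using mult[OF slin that, of "b j"] by (simp add: H_def rprod_Suc mult.assoc add.commute)
      have "L * (kdim emb H - kdim emb (U N)) \<le> L * (f (N + P) - f N)"
        using B(3) by (auto simp: f_def intro!: mult_left_mono)
      then show "L * (kdim emb H - kdim emb (U N)) < kdim emb (U N)"
        by (rule le_less_trans) (use LN in \<open>simp add: f_def\<close>)
    qed (use B sub that klinear_mult_left in auto)
  qed
  obtain u2 where u2: "u2 \<in> U N" "u2 \<noteq> 0" "\<And>i. i \<le> L \<Longrightarrow> u2 * lprod a i \<in> U N"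
  proof -
    \<comment> \<open>The mirror image, with \<open>r\<close> and multiplication on the
      right.\<close>
    define H where "H = {h. h * r \<in> U (N + P)}"
    obtain B where B: "finite B" "H \<subseteq> kspan emb B" "kdim emb H \<le> f (N + P)"
    proof -
      have "\<exists>B. finite B \<and> H \<subseteq> kspan emb B \<and> kdim emb H \<le> kdim emb (U (N + P))"
      proof (rule preimage_bound[OF F, of "\<lambda>y. y * inverse r"])
        fix h assume "h \<in> H"
        then show "\<exists>y\<in>U (N + P). h = y * inverse r"
          using right(1) by (intro bexI[of _ "h * r"]) (auto simp: H_def mult.assoc)
      qed (auto simp: algebra_simps)
      then show ?thesis using that by (auto simp: f_def)
    qed
    show ?thesis
    proof (rule inner_element[of "\<lambda>i u. u * lprod a i" "U N" B H L])
      show "U N \<subseteq> H" using mult[of _ N r P] right(2) UP by (auto simp: H_def)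
      show "u * lprod a (Suc i) \<in> H" if "u * lprod a i \<in> U N" for i u
        using mult[OF that rlin, of "a i"] by (simp add: H_def lprod_Suc mult.assoc)
      have "L * (kdim emb H - kdim emb (U N)) \<le> L * (f (N + P) - f N)"
        using B(3) by (auto simp: f_def intro!: mult_left_mono)
      then show "L * (kdim emb H - kdim emb (U N)) < kdim emb (U N)"
        by (rule le_less_trans) (use LN in \<open>simp add: f_def\<close>)
    qed (use B sub that klinear_mult_right in auto)
  qed
  obtain e where e: "\<And>k. k \<le> N \<Longrightarrow> e k \<in> U N"
    "\<And>d. (\<forall>k\<le>N. d k \<in> D) \<Longrightarrow> (\<Sum>k\<le>N. d k * (u1 * e k)) = 0 \<Longrightarrow> (\<forall>k\<le>N. d k = 0)"
    using indep[OF u1(2), of N] by blast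
  have Dsub: "vs.subspace D" "1 \<in> D" and Dm: "\<And>y z. y \<in> D \<Longrightarrow> z \<in> D \<Longrightarrow> y * z \<in> D"
    using D(1) by (auto simp: ksubalg_def ksubspace_eq)
  have linD: "lin g \<in> D" for g
    unfolding lin_def scl_def[symmetric] using D(2)
    by (intro vs.subspace_sum[OF Dsub(1)] vs.subspace_scale[OF Dsub(1)]) auto
  have lD: "lprod a i \<in> D" "rprod b i \<in> D" for i
    by (induction i) (auto simp: lprod_Suc rprod_Suc Dsub Dm linD)
  define v where "v = (\<lambda>((i, j), k). u2 * (lprod a i * rprod b j) * (u1 * e k))"
  define I where "I = ({..L} \<times> {..L}) \<times> {..N}"
  have "kindep emb I v"
    unfolding kindep_def
  proof (intro allI impI ballI)
    fix l t assume l: "(\<Sum>t\<in>I. emb (l t) * v t) = 0" and t: "t \<in> I"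
    define w where "w = (\<lambda>(i, j). lprod a i * rprod b j)"
    define d where "d k = (\<Sum>y\<in>{..L} \<times> {..L}. emb (l (y, k)) * w y)" for k
    have "(\<Sum>t\<in>I. emb (l t) * v t) = (\<Sum>y\<in>{..L} \<times> {..L}. \<Sum>k\<le>N. emb (l (y, k)) * (u2 * w y * (u1 * e k)))"
      unfolding I_def sum.cartesian_product
      by (intro sum.cong) (auto simp: v_def w_def split: prod.splits)
    also have "\<dots> = (\<Sum>k\<le>N. \<Sum>y\<in>{..L} \<times> {..L}. emb (l (y, k)) * (u2 * w y * (u1 * e k)))"
      by (rule sum.swap)
    also have "\<dots> = u2 * (\<Sum>k\<le>N. d k * (u1 * e k))"
      unfolding d_def sum_distrib_left sum_distrib_right
      by (intro sum.cong refl) (metis emb_left_comm mult.assoc)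
    finally have "(\<Sum>k\<le>N. d k * (u1 * e k)) = 0" using l u2(2) by simp
    moreover have "d k \<in> D" for k
      unfolding d_def scl_def[symmetric] w_def
      using Dm lD by (intro vs.subspace_sum[OF Dsub(1)] vs.subspace_scale[OF Dsub(1)]) auto
    ultimately have d0: "\<forall>k\<le>N. d k = 0" using e(2) by blast
    obtain y k where tk: "t = (y, k)" by (cases t)
    then have yk: "y \<in> {..L} \<times> {..L}" "k \<le> N" using t by (auto simp: I_def)
    have "(\<Sum>y\<in>{..L} \<times> {..L}. emb (l (y, k)) * w y) = 0" using d0 yk by (simp add: d_def)
    then show "l t = 0"
      using ab[unfolded kindep_def, rule_format, of "\<lambda>y. l (y, k)" y] yk tk by (simp add: w_def)
  qed
  moreover have "v ` I \<subseteq> U (3 * N)"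
  proof
    fix y assume "y \<in> v ` I"
    then obtain i j k where ijk: "i \<le> L" "j \<le> L" "k \<le> N" "y = u2 * (lprod a i * rprod b j) * (u1 * e k)"
      by (auto simp: v_def I_def)
    \<comment> \<open>Regrouped in this way, the element is a product of three factors from
      \<open>U N\<close>.\<close>
    have "(u2 * lprod a i) * (rprod b j * u1) * e k \<in> U (N + N + N)"
      using u1 u2 e ijk by (intro mult) auto
    moreover have "N + N + N = 3 * N" by simp
    ultimately show "y \<in> U (3 * N)" using ijk(4) by (simp add: mult.assoc)
  qed
  moreover obtain F3 where "finite F3" "U (3 * N) \<subseteq> kspan emb F3" using fin by blast
  ultimately have "card I \<le> f (3 * N)"
    unfolding f_def by (intro kindep_le_kdim[of I v]) (auto simp: I_def)
  then have "(L + 1) * (L + 1) * (N + 1) \<le> f (3 * N)" by (simp add: I_def card_cartesian_product)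
  then have "real ((L + 1) * (L + 1) * (N + 1)) \<le> real (f (3 * N))" by (rule of_nat_mono)
  also have "\<dots> < c * real (3 * N) ^ 3" using M[of "3 * N"] N(1) by simp
  also have "\<dots> = real N ^ 3 / (256 * real P ^ 2)" by (simp add: c_def power_mult_distrib)
  finally have up: "real (L + 1) ^ 2 * real (N + 1) < real N ^ 3 / (256 * real P ^ 2)"
    by (simp only: of_nat_mult power2_eq_square)
  have "N < (L + 1) * (16 * P)"
    unfolding L_def using P1 dividend_less_div_times[of "16 * P" N] by simp
  then have "real N < real (L + 1) * (16 * real P)" by (metis of_nat_less_iff of_nat_mult of_nat_numeral)
  then have "real N / (16 * real P) \<le> real (L + 1)" using P1 by (simp add: field_simps)
  then have "(real N / (16 * real P)) ^ 2 \<le> real (L + 1) ^ 2" by (intro power_mono) auto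
  then have "(real N / (16 * real P)) ^ 2 * real N \<le> real (L + 1) ^ 2 * real (N + 1)"
    by (intro mult_mono) auto
  moreover have "(real N / (16 * real P)) ^ 2 * real N = real N ^ 3 / (256 * real P ^ 2)"
    by (simp add: power_divide power_mult_distrib power2_eq_square power3_eq_cube)
  ultimately show False using up by simp
qed

end

section \<open>Extension of the base field\<close>

notation fls_nth (infixl \<open>$$\<close> 75)

text \<open>Any lower bounds may replace the subdegrees, so zero series need no separate
  treatment.\<close>

lemma fls_times_nth_bounds:
  fixes f g :: "'a::semiring_0 fls"
  assumes "\<And>i. i < a \<Longrightarrow> f $$ i = 0" "\<And>i. i < b \<Longrightarrow> g $$ i = 0"
  shows "(f * g) $$ n = (\<Sum>i=a..n - b. f $$ i * g $$ (n - i))"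
proof (cases "f = 0 \<or> g = 0")
  case False
  then have "a \<le> fls_subdegree f" "b \<le> fls_subdegree g"
    using assms by (meson nth_fls_subdegree_nonzero not_less)+
  then have "(\<Sum>i=fls_subdegree f..n - fls_subdegree g. f $$ i * g $$ (n - i)) = (\<Sum>i=a..n - b. f $$ i * g $$ (n - i))"
    by (intro sum.mono_neutral_left) (auto simp: not_le)
  then show ?thesis by (simp add: fls_times_nth(2))
qed auto

text \<open>For a finite-dimensional subspace this is its extension of scalars to Laurent
  series.\<close>

definition coeffs_in :: "'a::zero set \<Rightarrow> 'a fls set" where
  "coeffs_in S = {y. \<forall>n. y $$ n \<in> S}"

context central_algebra
begin

definition femb :: "'k fls \<Rightarrow> 'q fls" where "femb c = Abs_fls (\<lambda>n. emb (c $$ n))"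

lemma femb_nth [simp]: "femb c $$ n = emb (c $$ n)"
proof -
  obtain N where "\<forall>n<N. c $$ n = 0" by (rule fls_nth_vanishes_belowE)
  then have "\<exists>N. \<forall>n<N. emb (c $$ n) = 0" by (intro exI[of _ N]) simp
  then show ?thesis unfolding femb_def by (rule nth_Abs_fls_ex_lower_bound)
qed

lemma central_femb: "central_emb femb"
  unfolding central_emb_def
proof (intro conjI allI)
  show "femb 1 = 1" by (rule fls_eqI) simp
  show "femb (a + b) = femb a + femb b" for a b by (rule fls_eqI) (simp add: emb_add)
  fix a :: "'k fls"
  obtain A where A: "\<forall>n<A. a $$ n = 0" by (rule fls_nth_vanishes_belowE)
  show "femb (a * b) = femb a * femb b" for b
  proof (rule fls_eqI)
    fix n
    obtain B where B: "\<forall>n<B. b $$ n = 0" by (rule fls_nth_vanishes_belowE)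
    show "femb (a * b) $$ n = (femb a * femb b) $$ n"
      using A B by (simp add: fls_times_nth_bounds[of A _ B] emb_sum emb_mult)
  qed
  show "femb a * y = y * femb a" for y
  proof (rule fls_eqI)
    fix n
    obtain B where B: "\<forall>n<B. y $$ n = 0" by (rule fls_nth_vanishes_belowE)
    have "(femb a * y) $$ n = (\<Sum>i=A..n - B. emb (a $$ i) * y $$ (n - i))"
      using A B by (subst fls_times_nth_bounds[of A _ B]) auto
    also have "\<dots> = (\<Sum>i=B..n - A. y $$ i * emb (a $$ (n - i)))"
      by (rule sum.reindex_bij_witness[of _ "\<lambda>i. n - i" "\<lambda>i. n - i"]) (auto simp: emb_comm)
    also have "\<dots> = (y * femb a) $$ n"
      using A B by (subst fls_times_nth_bounds[of B _ A]) auto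
    finally show "(femb a * y) $$ n = (y * femb a) $$ n" .
  qed
qed

interpretation fl: central_algebra femb
  by unfold_locales (rule central_femb)

lemma fls_sum_nth': "(\<Sum>i\<in>I. g i) $$ n = (\<Sum>i\<in>I. g i $$ n)" for g :: "'i \<Rightarrow> 'q fls"
  by (induction I rule: infinite_finite_induct) auto

lemma coeffs_in_mult:
  assumes "y \<in> coeffs_in S" "z \<in> coeffs_in T" "\<And>s t. s \<in> S \<Longrightarrow> t \<in> T \<Longrightarrow> s * t \<in> R" "ksubspace emb R"
  shows "y * z \<in> coeffs_in R"
proof -
  obtain A where A: "\<forall>n<A. y $$ n = 0" by (rule fls_nth_vanishes_belowE)
  obtain B where B: "\<forall>n<B. z $$ n = 0" by (rule fls_nth_vanishes_belowE)
  have "(y * z) $$ n \<in> R" for n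
  proof -
    have "(y * z) $$ n = (\<Sum>i=A..n - B. y $$ i * z $$ (n - i))"
      using A B by (intro fls_times_nth_bounds) auto
    also have "\<dots> \<in> R" using assms by (intro vs.subspace_sum) (auto simp: ksubspace_eq coeffs_in_def)
    finally show ?thesis .
  qed
  then show ?thesis by (simp add: coeffs_in_def)
qed

lemma coeffs_in_subspace:
  assumes "ksubspace emb S"
  shows "ksubspace femb (coeffs_in S)"
proof -
  have S: "vs.subspace S" using assms by (simp add: ksubspace_eq)
  have "femb c * y \<in> coeffs_in S" if "y \<in> coeffs_in S" for c y
  proof (rule coeffs_in_mult[OF _ that _ assms, of _ "range emb"])
    show "femb c \<in> coeffs_in (range emb)" by (simp add: coeffs_in_def)
    show "s * t \<in> S" if "s \<in> range emb" "t \<in> S" for s t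
      using that vs.subspace_scale[OF S] by (auto simp: scl_def)
  qed
  then show ?thesis
    using vs.subspace_0[OF S] vs.subspace_add[OF S]
    by (auto simp: fl.ksubspace_eq fl.vs.subspace_def scl_def coeffs_in_def)
qed

lemma coeffs_in_const: "ksubspace emb S \<Longrightarrow> s \<in> S \<Longrightarrow> fls_const s \<in> coeffs_in S"
  using vs.subspace_0 by (auto simp: coeffs_in_def ksubspace_eq)

text \<open>A basis of \<open>S\<close> still spans: the coordinates of the coefficients of
  \<open>y\<close> at a fixed basis vector vanish far below and so form a Laurent series.\<close>

lemma coeffs_in_span:
  assumes "finite F" "S \<subseteq> kspan emb F"
  shows "\<exists>B. finite B \<and> coeffs_in S \<subseteq> kspan femb B \<and> kdim femb (coeffs_in S) \<le> kdim emb S"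
proof -
  obtain B where B: "B \<subseteq> S" "finite B" "vs.independent B" "S \<subseteq> kspan emb B" "card B = kdim emb S"
    using finite_basis[OF assms] by metis
  have sub: "coeffs_in S \<subseteq> kspan femb (fls_const ` B)"
  proof
    fix y assume y: "y \<in> coeffs_in S"
    define c where "c b = Abs_fls (\<lambda>n. vs.representation B (y $$ n) b)" for b
    obtain N where N: "\<forall>n<N. y $$ n = 0" by (rule fls_nth_vanishes_belowE)
    have c: "c b $$ n = vs.representation B (y $$ n) b" for b n
      unfolding c_def using N by (intro nth_Abs_fls_ex_lower_bound exI[of _ N]) (simp add: vs.representation_zero)
    have "y = (\<Sum>b\<in>B. femb (c b) * fls_const b)"
    proof (rule fls_eqI)
      fix n
      have "y $$ n \<in> vs.span B" using y B(4) by (auto simp: coeffs_in_def kspan_eq)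
      then have "(\<Sum>b\<in>B. scl emb (vs.representation B (y $$ n) b) b) = y $$ n"
        using vs.sum_representation_eq[OF B(3) _ B(2), of "y $$ n"] by simp
      then show "y $$ n = (\<Sum>b\<in>B. femb (c b) * fls_const b) $$ n"
        by (simp add: fls_sum_nth' fls_mult_const_nth c scl_def)
    qed
    also have "\<dots> \<in> fl.vs.span (fls_const ` B)"
      unfolding scl_def[symmetric] by (intro fl.vs.span_sum fl.vs.span_scale fl.vs.span_base) auto
    finally show "y \<in> kspan femb (fls_const ` B)" by (simp add: fl.kspan_eq)
  qed
  have "kdim femb (coeffs_in S) \<le> card (fls_const ` B)"
    using fl.vs.dim_le_card[of "coeffs_in S" "fls_const ` B"] sub B(2) by (auto simp: fl.kspan_eq fl.kdim_eq)
  also have "\<dots> \<le> kdim emb S" using card_image_le[OF B(2), of fls_const] B(5) by simp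
  finally show ?thesis using sub B(2) by blast
qed

lemma kindep_const:
  assumes "kindep emb T v"
  shows "kindep femb T (\<lambda>w. fls_const (v w))"
  unfolding kindep_def
proof (intro allI impI ballI)
  fix l w assume l: "(\<Sum>w\<in>T. femb (l w) * fls_const (v w)) = 0" and w: "w \<in> T"
  show "l w = 0"
  proof (rule fls_eqI)
    fix n
    have "(\<Sum>w\<in>T. emb (l w $$ n) * v w) = (\<Sum>w\<in>T. femb (l w) * fls_const (v w)) $$ n"
      by (simp add: fls_sum_nth' fls_mult_const_nth)
    then have "(\<Sum>w\<in>T. emb (l w $$ n) * v w) = 0" using l by simp
    then show "l w $$ n = 0 $$ n"
      using assms[unfolded kindep_def, rule_format, of "\<lambda>w. l w $$ n"] w by simp
  qed
qed

text \<open>Comparison of lowest terms: at the least order \<open>N\<close> of the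
  \<open>d k\<close>, a relation gives one over \<open>D\<close> involving the leading coefficient
  of \<open>u\<close>. It makes all \<open>d k $$ N\<close> vanish, against the choice of
  \<open>N\<close>.\<close>

lemma left_independent_const:
  fixes u :: "'q fls" and n :: nat
  assumes "u \<noteq> 0"
    and "\<And>d. (\<forall>k\<le>n. d k \<in> D) \<Longrightarrow> (\<Sum>k\<le>n. d k * (u $$ fls_subdegree u * b k)) = 0 \<Longrightarrow> (\<forall>k\<le>n. d k = 0)"
    and "\<forall>k\<le>n. d k \<in> coeffs_in D" "(\<Sum>k\<le>n. d k * (u * fls_const (b k))) = 0"
  shows "\<forall>k\<le>n. d k = 0"
proof (rule ccontr)
  assume "\<not> ?thesis"
  then have Z: "{k\<in>{..n}. d k \<noteq> 0} \<noteq> {}" by auto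
  define N where "N = Min ((\<lambda>k. fls_subdegree (d k)) ` {k\<in>{..n}. d k \<noteq> 0})"
  have fin: "finite ((\<lambda>k. fls_subdegree (d k)) ` {k\<in>{..n}. d k \<noteq> 0})"
    by (intro finite_imageI finite_subset[OF _ finite_atMost[of n]]) auto
  have "N \<in> (\<lambda>k. fls_subdegree (d k)) ` {k\<in>{..n}. d k \<noteq> 0}"
    unfolding N_def using Z by (intro Min_in[OF fin]) blast
  then obtain k0 where k0: "k0 \<le> n" "d k0 \<noteq> 0" "N = fls_subdegree (d k0)" by auto
  have low: "d k $$ i = 0" if "k \<le> n" "i < N" for k i
  proof (cases "d k = 0")
    case False
    then have "N \<le> fls_subdegree (d k)" unfolding N_def using that by (intro Min_le[OF fin]) auto
    then show ?thesis using that by simp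
  qed simp
  define m where "m = fls_subdegree u"
  have "(d k * (u * fls_const (b k))) $$ (N + m) = d k $$ N * (u $$ m * b k)" if "k \<le> n" for k
  proof -
    have "(d k * (u * fls_const (b k))) $$ (N + m) = (\<Sum>i=N..(N + m) - m. d k $$ i * (u * fls_const (b k)) $$ (N + m - i))"
      by (rule fls_times_nth_bounds) (use low that in \<open>auto simp: fls_mult_const_nth m_def\<close>)
    then show ?thesis by (simp add: fls_mult_const_nth)
  qed
  then have "(\<Sum>k\<le>n. d k $$ N * (u $$ m * b k)) = (\<Sum>k\<le>n. d k * (u * fls_const (b k))) $$ (N + m)"
    unfolding fls_sum_nth' by (intro sum.cong) auto
  then have "(\<Sum>k\<le>n. d k $$ N * (u $$ m * b k)) = 0" using assms(4) by simp
  moreover have "\<forall>k\<le>n. d k $$ N \<in> D" using assms(3) by (auto simp: coeffs_in_def)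
  ultimately have "\<forall>k\<le>n. d k $$ N = 0" unfolding m_def by (intro assms(2))
  then have "d k0 $$ N = 0" using k0(1) by blast
  then show False using k0 by simp
qed

end

lemma infinite_fls: "infinite (UNIV :: 'k::field fls set)"
proof
  assume fin: "finite (UNIV :: 'k fls set)"
  have "inj (\<lambda>n::nat. fls_X ^ n :: 'k fls)"
  proof (rule injI)
    fix m n :: nat assume "(fls_X :: 'k fls) ^ m = fls_X ^ n"
    then have "fls_subdegree ((fls_X :: 'k fls) ^ m) = fls_subdegree ((fls_X :: 'k fls) ^ n)" by simp
    then show "m = n" by (simp add: fls_subdegree_pow)
  qed
  then show False using finite_imageD[of "\<lambda>n::nat. fls_X ^ n :: 'k fls" UNIV] finite_subset[OF subset_UNIV fin] by auto
qed

context word_algebra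
begin

text \<open>A finite base field is made infinite by passing to Laurent series over \<open>'q\<close>, in which the
  variable is central.\<close>

theorem no_slow_filtration:
  fixes U :: "nat \<Rightarrow> 'q set"
  assumes sub: "\<And>n. ksubspace emb (U n)" and fin: "\<And>n. \<exists>F. finite F \<and> U n \<subseteq> kspan emb F"
    and one: "1 \<in> U 0" and mono: "\<And>n. U n \<subseteq> U (Suc n)"
    and mult: "\<And>m n y z. y \<in> U m \<Longrightarrow> z \<in> U n \<Longrightarrow> y * z \<in> U (m + n)"
    and small: "\<And>c. c > 0 \<Longrightarrow> \<exists>M. \<forall>n\<ge>M. real (kdim emb (U n)) < c * real n ^ 3"
    and D: "ksubalg emb D" "\<And>z. z < q \<Longrightarrow> x z \<in> D"
    and left: "s \<noteq> 0" "s \<in> U p" "\<And>z. z < q \<Longrightarrow> s * x z \<in> U p"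
    and right: "r \<noteq> 0" "r \<in> U p" "\<And>z. z < q \<Longrightarrow> x z * r \<in> U p"
    and indep: "\<And>u n. u \<noteq> 0 \<Longrightarrow> \<exists>b. (\<forall>k\<le>n. b k \<in> U n) \<and>
       (\<forall>d. (\<forall>k\<le>n. d k \<in> D) \<longrightarrow> (\<Sum>k\<le>n. d k * (u * b k)) = 0 \<longrightarrow> (\<forall>k\<le>n. d k = 0))"
    and growth: "\<And>c. \<exists>n T. finite T \<and> (\<forall>w\<in>T. set w \<subseteq> {..<q} \<and> length w \<le> n) \<and> c * (n + 1) < card T \<and> kindep emb T ev"
  shows False
proof -
  interpret F: word_algebra femb "\<lambda>z. fls_const (x z)" q by unfold_locales (rule central_femb)
  have ev: "F.ev w = fls_const (ev w)" for w
    by (induction w) (auto simp: F.ev_def ev_def)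
  have Dv: "ksubspace emb D" "1 \<in> D" "\<And>y z. y \<in> D \<Longrightarrow> z \<in> D \<Longrightarrow> y * z \<in> D" using D(1) by (auto simp: ksubalg_def)
  have span: "\<exists>B. finite B \<and> coeffs_in (U n) \<subseteq> kspan femb B \<and> kdim femb (coeffs_in (U n)) \<le> kdim emb (U n)" for n
  proof -
    obtain E where "finite E" "U n \<subseteq> kspan emb E" using fin by blast
    then show ?thesis by (rule coeffs_in_span)
  qed
  show False
  proof (rule F.slow_filtration_contradiction[of "\<lambda>n. coeffs_in (U n)" "coeffs_in D" "fls_const s" p "fls_const r"])
    show "\<exists>F. finite F \<and> coeffs_in (U n) \<subseteq> kspan femb F" for n
      using span by blast
    show "1 \<in> coeffs_in (U 0)" using coeffs_in_const[OF sub one] by simp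
    show "coeffs_in (U n) \<subseteq> coeffs_in (U (Suc n))" for n using mono by (auto simp: coeffs_in_def)
    show "y * z \<in> coeffs_in (U (m + n))" if "y \<in> coeffs_in (U m)" "z \<in> coeffs_in (U n)" for m n y z
      using coeffs_in_mult[OF that mult sub] .
    show "\<exists>M. \<forall>n\<ge>M. real (kdim femb (coeffs_in (U n))) < c * real n ^ 3" if "c > 0" for c
    proof -
      have "kdim femb (coeffs_in (U n)) \<le> kdim emb (U n)" for n using span by blast
      then show ?thesis using small[OF that] by (meson le_less_trans of_nat_mono)
    qed
    show "ksubalg femb (coeffs_in D)"
      unfolding ksubalg_def
      using coeffs_in_subspace[OF Dv(1)] coeffs_in_const[OF Dv(1,2)] coeffs_in_mult[OF _ _ Dv(3) Dv(1)] by auto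
    show "\<exists>b. (\<forall>k\<le>n. b k \<in> coeffs_in (U n)) \<and>
       (\<forall>d. (\<forall>k\<le>n. d k \<in> coeffs_in D) \<longrightarrow> (\<Sum>k\<le>n. d k * (u * b k)) = 0 \<longrightarrow> (\<forall>k\<le>n. d k = 0))"
      if u: "u \<noteq> 0" for u n
    proof -
      obtain b where b: "\<forall>k\<le>n. b k \<in> U n"
        "\<And>d. (\<forall>k\<le>n. d k \<in> D) \<Longrightarrow> (\<Sum>k\<le>n. d k * (u $$ fls_subdegree u * b k)) = 0 \<Longrightarrow> (\<forall>k\<le>n. d k = 0)"
        using indep[of "u $$ fls_subdegree u" n] u by auto
      show ?thesis
        using left_independent_const[OF u b(2)] b(1) coeffs_in_const[OF sub]
        by (intro exI[of _ "\<lambda>k. fls_const (b k)"]) blast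
    qed
    show "\<exists>n T. finite T \<and> (\<forall>w\<in>T. set w \<subseteq> {..<q} \<and> length w \<le> n) \<and> c * (n + 1) < card T \<and> kindep femb T F.ev" for c
    proof -
      obtain n T where "finite T" "\<forall>w\<in>T. set w \<subseteq> {..<q} \<and> length w \<le> n" "c * (n + 1) < card T" "kindep emb T ev"
        using growth[of c] by metis
      moreover have "F.ev = (\<lambda>w. fls_const (ev w))" using ev by auto
      ultimately show ?thesis using kindep_const by metis
    qed
    show "fls_const s * fls_const (x z) \<in> coeffs_in (U p)" if "z < q" for z
      using coeffs_in_const[OF sub left(3)[OF that]] by simp
    show "fls_const (x z) * fls_const r \<in> coeffs_in (U p)" if "z < q" for z
      using coeffs_in_const[OF sub right(3)[OF that]] by simp
  qed (use infinite_fls coeffs_in_subspace[OF sub] coeffs_in_const[OF sub] coeffs_in_const[OF Dv(1)] D(2) left(1,2) right(1,2) in auto)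
qed

end

section \<open>Powers of a generating space\<close>

context central_algebra
begin

lemma kspan_mult:
  assumes "y \<in> kspan emb S" "z \<in> kspan emb T" "\<And>s t. s \<in> S \<Longrightarrow> t \<in> T \<Longrightarrow> s * t \<in> kspan emb R"
  shows "y * z \<in> kspan emb R"
proof -
  have "1 * y * t \<in> kspan emb R" if "t \<in> T" for t
    by (rule kspan_two_sided[OF assms(1)]) (use assms(3) that in simp)
  then have "y * z * 1 \<in> kspan emb R"
    by (intro kspan_two_sided[OF assms(2)]) simp
  then show ?thesis by simp
qed

lemma spow_subspace: "ksubspace emb (spow emb V n)"
  by (simp add: spow_def ksubspace_eq kspan_eq)

lemma spow_prod_list: "length xs = n \<Longrightarrow> set xs \<subseteq> V \<Longrightarrow> prod_list xs \<in> spow emb V n"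
  unfolding spow_def kspan_eq by (rule vs.span_base) blast

lemma spow_one: "1 \<in> spow emb V 0"
  using spow_prod_list[of "[]"] by simp

lemma spow_base: "v \<in> V \<Longrightarrow> v \<in> spow emb V 1"
  using spow_prod_list[of "[v]"] by simp

lemma spow_mult: "y \<in> spow emb V m \<Longrightarrow> z \<in> spow emb V n \<Longrightarrow> y * z \<in> spow emb V (m + n)"
  unfolding spow_def
proof (erule kspan_mult, assumption)
  fix s t assume "s \<in> {prod_list xs | xs. length xs = m \<and> set xs \<subseteq> V}" "t \<in> {prod_list xs | xs. length xs = n \<and> set xs \<subseteq> V}"
  then obtain xs ys where "s = prod_list xs" "t = prod_list ys" "length xs = m" "length ys = n" "set xs \<subseteq> V" "set ys \<subseteq> V"
    by blast
  then show "s * t \<in> kspan emb {prod_list xs | xs. length xs = m + n \<and> set xs \<subseteq> V}"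
    unfolding kspan_eq by (intro vs.span_base CollectI exI[of _ "xs @ ys"]) auto
qed

lemma spow_Suc_mono: "1 \<in> V \<Longrightarrow> spow emb V n \<subseteq> spow emb V (Suc n)"
  using spow_mult[OF spow_base, of 1 V _ n] by auto

lemma spow_mono: "1 \<in> V \<Longrightarrow> m \<le> n \<Longrightarrow> spow emb V m \<subseteq> spow emb V n"
  using lift_Suc_mono_le[of "spow emb V"] spow_Suc_mono by blast

lemma spow_finite_span:
  assumes "finite F" "V \<subseteq> kspan emb F"
  shows "spow emb V n \<subseteq> kspan emb {prod_list xs | xs. length xs = n \<and> set xs \<subseteq> F}"
    and "finite {prod_list xs | xs. length xs = n \<and> set xs \<subseteq> F}"
proof -
  have "prod_list xs \<in> kspan emb {prod_list xs | xs. length xs = n \<and> set xs \<subseteq> F}"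
    if "length xs = n" "set xs \<subseteq> V" for xs n
    using that
  proof (induction xs arbitrary: n)
    case Nil
    then show ?case unfolding kspan_eq by (intro vs.span_base CollectI exI[of _ "[]"]) auto
  next
    case (Cons v xs)
    have "v * prod_list xs \<in> kspan emb {prod_list xs | xs. length xs = n \<and> set xs \<subseteq> F}"
    proof (rule kspan_mult)
      show "v \<in> kspan emb F" using Cons.prems assms(2) by auto
      show "prod_list xs \<in> kspan emb {prod_list xs | xs. length xs = n - 1 \<and> set xs \<subseteq> F}"
        using Cons by auto
      fix s t assume "s \<in> F" "t \<in> {prod_list xs | xs. length xs = n - 1 \<and> set xs \<subseteq> F}"
      then obtain ys where "t = prod_list ys" "length ys = n - 1" "set ys \<subseteq> F" by blast
      then show "s * t \<in> kspan emb {prod_list xs | xs. length xs = n \<and> set xs \<subseteq> F}"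
        unfolding kspan_eq using Cons.prems \<open>s \<in> F\<close> by (intro vs.span_base CollectI exI[of _ "s # ys"]) auto
    qed
    then show ?case by simp
  qed
  then show "spow emb V n \<subseteq> kspan emb {prod_list xs | xs. length xs = n \<and> set xs \<subseteq> F}"
    unfolding spow_def kspan_eq by (intro vs.span_minimal) auto
  have "{prod_list xs | xs. length xs = n \<and> set xs \<subseteq> F} = prod_list ` {xs. set xs \<subseteq> F \<and> length xs = n}" by auto
  then show "finite {prod_list xs | xs. length xs = n \<and> set xs \<subseteq> F}"
    using finite_lists_length_eq[OF assms(1)] by simp
qed

section \<open>Generated subalgebras and growth exponents\<close>

lemma alg_gen_subalg: "ksubalg emb (alg_gen emb S)"
  by (auto simp: alg_gen_def ksubalg_def ksubspace_eq vs.subspace_def)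

lemma alg_gen_base: "S \<subseteq> alg_gen emb S"
  by (auto simp: alg_gen_def)

lemma alg_gen_least: "ksubalg emb B \<Longrightarrow> S \<subseteq> B \<Longrightarrow> alg_gen emb S \<subseteq> B"
  by (auto simp: alg_gen_def)

lemma alg_gen_spow:
  assumes "1 \<in> V"
  shows "alg_gen emb V = (\<Union>n. spow emb V n)"
proof
  let ?U = "\<Union>n. spow emb V n"
  show "alg_gen emb V \<subseteq> ?U"
  proof (rule alg_gen_least)
    have "y + z \<in> ?U" if yz: "y \<in> ?U" "z \<in> ?U" for y z
    proof -
      obtain m n where "y \<in> spow emb V m" "z \<in> spow emb V n" using yz by blast
      then have "y \<in> spow emb V (max m n)" "z \<in> spow emb V (max m n)"
        using spow_mono[OF assms, of m "max m n"] spow_mono[OF assms, of n "max m n"] by auto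
      then have "y + z \<in> spow emb V (max m n)"
        using spow_subspace[of V "max m n"] vs.subspace_add by (auto simp: ksubspace_eq)
      then show ?thesis by blast
    qed
    moreover have "scl emb c y \<in> ?U" if "y \<in> ?U" for c y
      using that spow_subspace vs.subspace_scale unfolding ksubspace_eq by blast
    moreover have "y * z \<in> ?U" if "y \<in> ?U" "z \<in> ?U" for y z using that spow_mult by blast
    moreover have "0 \<in> ?U" using spow_subspace[of V 0] vs.subspace_0 by (auto simp: ksubspace_eq)
    moreover have "1 \<in> ?U" using spow_one by blast
    ultimately show "ksubalg emb ?U" by (simp add: ksubalg_def ksubspace_eq vs.subspace_def)
    show "V \<subseteq> ?U" using spow_base by blast
  qed
  show "?U \<subseteq> alg_gen emb V"
  proof (rule UN_least)
    fix n
    have "prod_list xs \<in> alg_gen emb V" if "set xs \<subseteq> V" for xs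
      using that alg_gen_subalg[of V] alg_gen_base[of V] by (induction xs) (auto simp: ksubalg_def)
    then show "spow emb V n \<subseteq> alg_gen emb V"
      unfolding spow_def kspan_eq using alg_gen_subalg[of V]
      by (intro vs.span_minimal) (auto simp: ksubalg_def ksubspace_eq)
  qed
qed

text \<open>\<open>gkdim_fg\<close> rests on a choice; the span of 1 and a finite generating set
  shows that an admissible space exists, so the chosen one is admissible.\<close>

lemma fg_subalg_generating_space:
  assumes "fg_subalg emb C"
  obtains V F where "gkdim_fg emb C = growth emb V" "finite F" "V = kspan emb F" "1 \<in> V" "alg_gen emb V = C"
proof -
  obtain S where S: "finite S" "C = alg_gen emb S" using assms by (auto simp: fg_subalg_def)
  let ?P = "\<lambda>V. ksubspace emb V \<and> kfindim emb V \<and> 1 \<in> V \<and> alg_gen emb V = C"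
  let ?V = "kspan emb (insert 1 S)"
  have "alg_gen emb ?V = C"
  proof
    have "insert 1 S \<subseteq> C" using alg_gen_subalg[of S] alg_gen_base[of S] S(2) by (auto simp: ksubalg_def)
    then have "?V \<subseteq> C" unfolding kspan_eq using alg_gen_subalg[of S] S(2)
      by (intro vs.span_minimal) (auto simp: ksubalg_def ksubspace_eq)
    then show "alg_gen emb ?V \<subseteq> C" using alg_gen_subalg[of S] S(2) by (intro alg_gen_least) auto
    have "S \<subseteq> ?V" unfolding kspan_eq using vs.span_superset[of "insert 1 S"] by auto
    then have "S \<subseteq> alg_gen emb ?V" using alg_gen_base by blast
    then show "C \<subseteq> alg_gen emb ?V" unfolding S(2) using alg_gen_subalg by (intro alg_gen_least) auto
  qed
  moreover have "1 \<in> ?V" unfolding kspan_eq by (intro vs.span_base) simp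
  moreover have "ksubspace emb ?V" by (simp add: ksubspace_eq kspan_eq)
  moreover have "kfindim emb ?V" unfolding kfindim_def using S(1) by (intro exI[of _ "insert 1 S"]) simp
  ultimately have "?P ?V" by blast
  then have "?P (SOME V. ?P V)" by (rule someI)
  then show ?thesis using that[of "SOME V. ?P V"] unfolding gkdim_fg_def kfindim_def by blast
qed

text \<open>For a real \<open>r\<close> strictly between the growth and 3 the dimension is
  eventually below \<open>n powr r\<close>, and \<open>n powr (r - 3)\<close> tends to 0.\<close>

lemma growth_less_3:
  assumes "growth emb V < 3" "\<And>n. kdim emb (spow emb V n) \<ge> 1" "c > 0"
  shows "\<exists>M. \<forall>n\<ge>M. real (kdim emb (spow emb V n)) < c * real n ^ 3"
proof -
  obtain y where y: "growth emb V < y" "y < 3" using dense[OF assms(1)] by blast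
  then obtain r where r: "y = ereal r" by (cases y) auto
  have "r < 3" using y(2) r by (metis ereal_less(2) less_ereal.simps(1) numeral_eq_ereal)
  have "eventually (\<lambda>n. ereal (ln (real (kdim emb (spow emb V n))) / ln (real n)) < y) sequentially"
    using y(1) unfolding growth_def by (rule Limsup_lessD)
  moreover have "eventually (\<lambda>n. real n powr r < c * real n ^ 3) sequentially"
  proof -
    have "((\<lambda>n. real n powr (r - 3)) \<longlongrightarrow> 0) sequentially"
      using \<open>r < 3\<close> by (intro tendsto_neg_powr filterlim_real_sequentially) simp
    then have "eventually (\<lambda>n. real n powr (r - 3) < c) sequentially" using assms(3) by (rule order_tendstoD(2))
    then show ?thesis using eventually_gt_at_top[of 0]
    proof eventually_elim
      case (elim n)
      have "real n powr r = real n powr (r - 3) * real n ^ 3"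
        using elim(2) powr_add[of "real n" "r - 3" 3] by simp
      also have "\<dots> < c * real n ^ 3" using elim by (intro mult_strict_right_mono) auto
      finally show ?case .
    qed
  qed
  ultimately have "eventually (\<lambda>n. real (kdim emb (spow emb V n)) < c * real n ^ 3) sequentially"
    using eventually_ge_at_top[of 2]
  proof eventually_elim
    case (elim n)
    have "ln (real (kdim emb (spow emb V n))) / ln (real n) < r" using elim(1) r by simp
    then have "ln (real (kdim emb (spow emb V n))) < r * ln (real n)" using elim(3) by (simp add: field_simps)
    then have "exp (ln (real (kdim emb (spow emb V n)))) < exp (r * ln (real n))" by simp
    moreover have "real (kdim emb (spow emb V n)) > 0" using assms(2)[of n] by linarith
    ultimately have "real (kdim emb (spow emb V n)) < real n powr r" using elim(3) by (simp add: powr_def)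
    then show ?case using elim(2) by simp
  qed
  then show ?thesis by (simp add: eventually_sequentially)
qed

lemma growth_le_1:
  assumes "\<And>n. kdim emb (spow emb V n) \<le> c * (n + 1)"
  shows "growth emb V \<le> 1"
proof -
  \<comment> \<open>The successor keeps the argument of the logarithm at least 1, also for
    \<open>c = 0\<close>.\<close>
  define C where "C = real (Suc c)"
  have C: "C > 0" by (simp add: C_def)
  have "((\<lambda>n. ln (C * (real n + 1)) / ln (real n)) \<longlongrightarrow> 1) sequentially"
    using C by real_asymp
  then have lim: "limsup (\<lambda>n. ereal (ln (C * (real n + 1)) / ln (real n))) = 1"
    by (intro lim_imp_Limsup) (auto simp: one_ereal_def)
  have "growth emb V \<le> limsup (\<lambda>n. ereal (ln (C * (real n + 1)) / ln (real n)))"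
    unfolding growth_def
  proof (rule Limsup_mono)
    show "eventually (\<lambda>n. ereal (ln (real (kdim emb (spow emb V n))) / ln (real n))
        \<le> ereal (ln (C * (real n + 1)) / ln (real n))) sequentially"
      using eventually_ge_at_top[of 2]
    proof eventually_elim
      case (elim n)
      have "real (kdim emb (spow emb V n)) \<le> real c * (real n + 1)"
        using of_nat_mono[OF assms[of n], where ?'a = real] by (simp add: algebra_simps)
      also have "\<dots> \<le> C * (real n + 1)" by (simp add: C_def)
      finally have le: "real (kdim emb (spow emb V n)) \<le> C * (real n + 1)" .
      have ge1: "1 \<le> C * (real n + 1)" by (simp add: C_def algebra_simps)
      have "ln (real (kdim emb (spow emb V n))) \<le> ln (C * (real n + 1))"
      proof (cases "kdim emb (spow emb V n) = 0")
        case False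
        then show ?thesis using le by (intro ln_mono) auto
      qed (use ge1 in simp)
      then show ?case using elim by (simp add: divide_right_mono)
    qed
  qed
  then show ?thesis using lim by simp
qed

end

section \<open>Quotient division algebras\<close>

locale filtered_quotient = central_algebra emb
  for emb :: "'k::field \<Rightarrow> 'q::division_ring" +
  fixes V :: "'q set" and F :: "'q set"
  assumes F: "finite F" "V = kspan emb F" and V1: "1 \<in> V"
    and quot: "is_quotient_ring (alg_gen emb V)"
    and small: "\<And>c. c > 0 \<Longrightarrow> \<exists>M. \<forall>n\<ge>M. real (kdim emb (spow emb V n)) < c * real n ^ 3"
begin

abbreviation "A \<equiv> alg_gen emb V"
abbreviation "U \<equiv> spow emb V"

lemma A_eq: "A = (\<Union>n. U n)" by (rule alg_gen_spow[OF V1])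

lemma A_ring: "0 \<in> A" "1 \<in> A" "\<And>y z. y \<in> A \<Longrightarrow> z \<in> A \<Longrightarrow> y + z \<in> A"
  "\<And>y z. y \<in> A \<Longrightarrow> z \<in> A \<Longrightarrow> y * z \<in> A" "\<And>c y. y \<in> A \<Longrightarrow> emb c * y \<in> A"
  using alg_gen_subalg[of V] by (auto simp: ksubalg_def ksubspace_eq vs.subspace_def scl_def)

lemma A_minus: "y \<in> A \<Longrightarrow> - y \<in> A"
  using A_ring(5)[of y "-1"] by (simp add: emb_minus)

lemma U_finite: "\<exists>E. finite E \<and> U n \<subseteq> kspan emb E"
  using spow_finite_span[OF F(1), of V n] F(2) by auto

lemma U_dim: "kdim emb (U n) \<ge> 1"
proof -
  obtain E where "finite E" "U n \<subseteq> kspan emb E" using U_finite by blast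
  then show ?thesis using spow_one spow_mono[OF V1, of 0 n] by (intro kdim_ge_1) auto
qed

text \<open>The quotient ring supplies right fractions only; the left Ore condition comes from
  growth. If it failed for \<open>y = a * inverse s\<close>, then \<open>A * a\<close> and
  \<open>A * s\<close> would be independent, and the dimension would double every \<open>p\<close>
  steps.\<close>

lemma left_denominator: "\<exists>c\<in>A. c \<noteq> 0 \<and> c * y \<in> A"
proof (rule ccontr)
  assume "\<not> ?thesis"
  then have no: "c = 0" if "c \<in> A" "c * y \<in> A" for c using that by blast
  obtain a s where as: "a \<in> A" "s \<in> A" "s \<noteq> 0" "y = a * inverse s"
    using quot unfolding is_quotient_ring_def by blast
  obtain m n where mn: "a \<in> U m" "s \<in> U n" using as A_eq by blast
  define p where "p = Suc (max m n)"
  have "m \<le> p" "n \<le> p" by (auto simp: p_def)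
  then have p: "a \<in> U p" "s \<in> U p" "p \<ge> 1"
    using mn spow_mono[OF V1] by (blast, blast, simp add: p_def)
  have double: "2 * kdim emb (U N) \<le> kdim emb (U (N + p))" for N
  proof -
    obtain E where E: "finite E" "U N \<subseteq> kspan emb E" using U_finite by blast
    obtain B where B: "B \<subseteq> U N" "finite B" "vs.independent B" "card B = kdim emb (U N)"
      using finite_basis[OF E] by metis
    define v where "v = (\<lambda>(b, i). b * (if i then a else s))"
    have AU: "(\<Sum>b\<in>B. emb (g b) * b) \<in> A" for g
    proof -
      have "(\<Sum>b\<in>B. scl emb (g b) b) \<in> U N"
        using spow_subspace[of V N] B(1) by (auto simp: ksubspace_eq intro!: vs.subspace_sum vs.subspace_scale)
      then show ?thesis using A_eq by (auto simp: scl_def)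
    qed
    have "kindep emb (B \<times> UNIV) v"
      unfolding kindep_def
    proof (intro allI impI ballI)
      fix l t assume l: "(\<Sum>t\<in>B \<times> UNIV. emb (l t) * v t) = 0" and t: "t \<in> B \<times> (UNIV :: bool set)"
      define c d where "c = (\<Sum>b\<in>B. emb (l (b, True)) * b)" and "d = (\<Sum>b\<in>B. emb (l (b, False)) * b)"
      have "(\<Sum>t\<in>B \<times> UNIV. emb (l t) * v t) = (\<Sum>b\<in>B. \<Sum>i\<in>UNIV. emb (l (b, i)) * v (b, i))"
        by (simp add: sum.cartesian_product)
      also have "\<dots> = c * a + d * s"
        by (simp add: UNIV_bool v_def c_def d_def sum_distrib_right sum.distrib mult.assoc add.commute)
      finally have cd: "c * a = - (d * s)" using l by (simp add: eq_neg_iff_add_eq_0)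
      have "c * y = - d" unfolding as(4) using cd as(3) by (simp add: mult.assoc[symmetric]) (simp add: mult.assoc)
      then have "c * y \<in> A" using A_minus AU by (simp add: d_def)
      then have "c = 0" using no AU by (simp add: c_def)
      then have "d = 0" using cd as(3) by simp
      have i: "\<And>g. (\<Sum>b\<in>B. emb (g b) * b) = 0 \<Longrightarrow> (\<forall>b\<in>B. g b = 0)"
        using kindep_independent[OF B(2,3)] by (simp add: kindep_def)
      have "\<forall>b\<in>B. l (b, True) = 0" "\<forall>b\<in>B. l (b, False) = 0"
        using i[of "\<lambda>b. l (b, True)"] i[of "\<lambda>b. l (b, False)"] \<open>c = 0\<close> \<open>d = 0\<close> by (simp_all add: c_def d_def)
      moreover obtain b i where "t = (b, i)" "b \<in> B" using t by blast
      ultimately show "l t = 0" by (cases i) auto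
    qed
    moreover have "v ` (B \<times> UNIV) \<subseteq> U (N + p)"
      using B(1) p spow_mult by (auto simp: v_def)
    moreover obtain E' where "finite E'" "U (N + p) \<subseteq> kspan emb E'" using U_finite by blast
    ultimately have "card (B \<times> (UNIV :: bool set)) \<le> kdim emb (U (N + p))"
      by (intro kindep_le_kdim[of _ v]) (use B(2) in auto)
    then show ?thesis using B(4) by (simp add: card_cartesian_product)
  qed
  obtain N where N: "N \<ge> 16 * p" "(N div (16 * p)) * (kdim emb (U (N + p)) - kdim emb (U N)) < kdim emb (U N)"
    using slow_growth_scale[of "\<lambda>n. kdim emb (U n)" p "16 * p", OF U_dim small p(3)] by blast
  \<comment> \<open>With this quotient at least 1, the slow scale says that the dimension grows by
    less than \<open>kdim emb (U N)\<close> over \<open>p\<close> steps, which contradicts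
    doubling.\<close>
  have "1 \<le> N div (16 * p)" using N(1) p(3) by (simp add: Suc_le_eq div_greater_zero_iff)
  moreover have "kdim emb (U N) \<le> kdim emb (U (N + p)) - kdim emb (U N)" using double[of N] by simp
  ultimately have "1 * kdim emb (U N) \<le> (N div (16 * p)) * (kdim emb (U (N + p)) - kdim emb (U N))"
    by (intro mult_le_mono)
  then show False using N(2) by simp
qed

lemma common_left_denominator: "\<exists>s\<in>A. s \<noteq> 0 \<and> (\<forall>z<q. s * x z \<in> A)" for q :: nat
proof (induction q)
  case 0
  then show ?case using A_ring(2) by (intro bexI[of _ 1]) auto
next
  case (Suc q)
  then obtain s where s: "s \<in> A" "s \<noteq> 0" "\<forall>z<q. s * x z \<in> A" by blast
  obtain c where "c \<in> A" "c \<noteq> 0" "c * (s * x q) \<in> A" using left_denominator by blast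
  then show ?case using s A_ring(4)
    by (intro bexI[of _ "c * s"]) (auto simp: less_Suc_eq mult.assoc)
qed

lemma common_right_denominator: "\<exists>s\<in>A. s \<noteq> 0 \<and> (\<forall>z<q. x z * s \<in> A)" for q :: nat
proof (induction q)
  case 0
  then show ?case using A_ring(2) by (intro bexI[of _ 1]) auto
next
  case (Suc q)
  then obtain s where s: "s \<in> A" "s \<noteq> 0" "\<forall>z<q. x z * s \<in> A" by blast
  obtain a c where ac: "a \<in> A" "c \<in> A" "c \<noteq> 0" "x q * s = a * inverse c"
    using quot unfolding is_quotient_ring_def by blast
  have "x q * s * c = a" using ac by (simp add: mult.assoc)
  then show ?case using s ac A_ring(4)
    by (intro bexI[of _ "s * c"]) (auto simp: less_Suc_eq mult.assoc[symmetric])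
qed

lemma A_mem_U: "y \<in> A \<Longrightarrow> \<exists>n. y \<in> U n" using A_eq by blast

lemma finite_mem_U:
  fixes q :: nat
  assumes "\<And>z. z < q \<Longrightarrow> y z \<in> A"
  shows "\<exists>p. \<forall>z<q. y z \<in> U p"
  using assms
proof (induction q)
  case (Suc q)
  then obtain p where p: "\<forall>z<q. y z \<in> U p" by auto
  obtain n where n: "y q \<in> U n" using Suc.prems A_mem_U by blast
  show ?case
    using p n spow_mono[OF V1, of p "max p n"] spow_mono[OF V1, of n "max p n"]
    by (intro exI[of _ "max p n"]) (auto simp: less_Suc_eq)
qed simp

text \<open>Either some \<open>u * y\<close> with \<open>y\<close> in \<open>U (Suc n)\<close> lies
  outside the left \<open>D\<close>-span \<open>G\<close> of the elements found so far and prolongs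
  the family, or \<open>G\<close> is stable under right multiplication by \<open>A\<close> and by
  inverses of its nonzero elements. In the second case \<open>G\<close> contains \<open>u\<close>,
  hence everything.\<close>

lemma left_independent_exists:
  assumes D: "div_subalg emb D" and nf: "\<not> left_findim D" and u: "u \<noteq> 0"
  shows "\<exists>b. (\<forall>k\<le>n. b k \<in> U n) \<and>
       (\<forall>d. (\<forall>k\<le>n. d k \<in> D) \<longrightarrow> (\<Sum>k\<le>n. d k * (u * b k)) = 0 \<longrightarrow> (\<forall>k\<le>n. d k = 0))"
proof (induction n)
  case 0
  then show ?case using u spow_one by (intro exI[of _ "\<lambda>_. 1"]) auto
next
  case (Suc n)
  have Ds: "vs.subspace D" and Dr: "1 \<in> D" "\<And>y z. y \<in> D \<Longrightarrow> z \<in> D \<Longrightarrow> y * z \<in> D" "\<And>y. y \<in> D \<Longrightarrow> inverse y \<in> D"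
    using D by (auto simp: div_subalg_def ksubalg_def ksubspace_eq)
  have D0: "0 \<in> D" and Da: "\<And>y z. y \<in> D \<Longrightarrow> z \<in> D \<Longrightarrow> y + z \<in> D" and Dm: "\<And>y. y \<in> D \<Longrightarrow> - y \<in> D"
    using Ds vs.subspace_0 vs.subspace_add vs.subspace_neg by auto
  obtain b where b: "\<forall>k\<le>n. b k \<in> U n"
    and ind: "\<And>d. (\<forall>k\<le>n. d k \<in> D) \<Longrightarrow> (\<Sum>k\<le>n. d k * (u * b k)) = 0 \<Longrightarrow> (\<forall>k\<le>n. d k = 0)"
    using Suc by blast
  define w where "w k = u * b k" for k
  define G where "G = {(\<Sum>k\<le>n. d k * w k) | d. \<forall>k\<le>n. d k \<in> D}"
  show ?case
  proof (cases "\<forall>y\<in>U (Suc n). u * y \<in> G")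
    case False
    then obtain y where y: "y \<in> U (Suc n)" "u * y \<notin> G" by blast
    have "\<forall>k\<le>Suc n. d k = 0" if d: "\<forall>k\<le>Suc n. d k \<in> D" "(\<Sum>k\<le>Suc n. d k * (u * (b(Suc n := y)) k)) = 0" for d
    proof -
      have s: "(\<Sum>k\<le>n. d k * w k) + d (Suc n) * (u * y) = 0"
        using d(2) by (simp add: w_def)
      have "d (Suc n) = 0"
      proof (rule ccontr)
        assume nz: "d (Suc n) \<noteq> 0"
        have "d (Suc n) * (u * y) = - (\<Sum>k\<le>n. d k * w k)" using s by (simp add: eq_neg_iff_add_eq_0 add.commute)
        then have "inverse (d (Suc n)) * (d (Suc n) * (u * y)) = inverse (d (Suc n)) * - (\<Sum>k\<le>n. d k * w k)" by simp
        then have "u * y = (\<Sum>k\<le>n. (- (inverse (d (Suc n)) * d k)) * w k)"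
          using nz by (simp add: mult.assoc[symmetric] sum_distrib_left sum_negf)
        moreover have "\<forall>k\<le>n. - (inverse (d (Suc n)) * d k) \<in> D" using d(1) Dm Dr by simp
        ultimately have "u * y \<in> G" unfolding G_def
          by (intro CollectI exI[of _ "\<lambda>k. - (inverse (d (Suc n)) * d k)"] conjI)
        then show False using y(2) by blast
      qed
      moreover from this have "\<forall>k\<le>n. d k = 0" using s d(1) by (intro ind) (auto simp: w_def)
      ultimately show ?thesis by (simp add: le_Suc_eq)
    qed
    moreover have "\<forall>k\<le>Suc n. (b(Suc n := y)) k \<in> U (Suc n)"
      using b y(1) spow_Suc_mono[OF V1, of n] by auto
    ultimately show ?thesis by blast
  next
    case True
    have Gsum: "y + z \<in> G" if yz: "y \<in> G" "z \<in> G" for y z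
    proof -
      obtain d e where "\<forall>k\<le>n. d k \<in> D" "\<forall>k\<le>n. e k \<in> D" "y = (\<Sum>k\<le>n. d k * w k)" "z = (\<Sum>k\<le>n. e k * w k)"
        using yz unfolding G_def by blast
      then show ?thesis unfolding G_def
        by (intro CollectI exI[of _ "\<lambda>k. d k + e k"]) (auto simp: algebra_simps sum.distrib Da)
    qed
    have Gmul: "c * y \<in> G" if cy: "c \<in> D" "y \<in> G" for c y
    proof -
      obtain d where "\<forall>k\<le>n. d k \<in> D" "y = (\<Sum>k\<le>n. d k * w k)" using cy(2) unfolding G_def by blast
      then show ?thesis unfolding G_def
        by (intro CollectI exI[of _ "\<lambda>k. c * d k"]) (auto simp: sum_distrib_left mult.assoc Dr cy)
    qed
    have G0: "0 \<in> G" unfolding G_def by (intro CollectI exI[of _ "\<lambda>_. 0"]) (auto simp: D0)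
    have Gs: "sum g I \<in> G" if "\<And>i. i \<in> I \<Longrightarrow> g i \<in> G" for g :: "nat \<Rightarrow> 'q" and I
      using that by (induction I rule: infinite_finite_induct) (auto simp: G0 Gsum)
    have embD: "emb c \<in> D" for c using vs.subspace_scale[OF Ds Dr(1), of c] by (simp add: scl_def)
    \<comment> \<open>The right stabiliser of \<open>G\<close> is a subalgebra, so it contains
      \<open>A\<close> once it contains \<open>V\<close>.\<close>
    define R where "R = {a. \<forall>g\<in>G. g * a \<in> G}"
    have "emb c * a \<in> R" if "a \<in> R" for c a
      using that Gmul[OF embD] by (simp add: R_def emb_left_comm)
    moreover have "a * c \<in> R" if "a \<in> R" "c \<in> R" for a c
      using that by (simp add: R_def mult.assoc[symmetric])
    moreover have "a + c \<in> R" if "a \<in> R" "c \<in> R" for a c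
      using that Gsum by (simp add: R_def distrib_left)
    moreover have "0 \<in> R" "1 \<in> R" using G0 by (simp_all add: R_def)
    ultimately have "ksubalg emb R"
      by (simp add: ksubalg_def ksubspace_eq vs.subspace_def scl_def)
    moreover have "V \<subseteq> R"
    proof
      fix v assume v: "v \<in> V"
      have "g * v \<in> G" if g: "g \<in> G" for g
      proof -
        obtain d where d: "\<forall>k\<le>n. d k \<in> D" "g = (\<Sum>k\<le>n. d k * w k)" using g unfolding G_def by blast
        have "w k * v \<in> G" if "k \<le> n" for k
          using True spow_mult[of "b k" V n v 1] b that spow_base[OF v] by (simp add: w_def mult.assoc)
        then have "(\<Sum>k\<le>n. d k * (w k * v)) \<in> G" using d(1) by (intro Gs) (simp add: Gmul)
        then show ?thesis using d(2) by (simp add: sum_distrib_right mult.assoc)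
      qed
      then show "v \<in> R" by (simp add: R_def)
    qed
    ultimately have AR: "A \<subseteq> R" by (rule alg_gen_least)
    have "1 \<in> U (Suc n)" using spow_one spow_mono[OF V1, of 0 "Suc n"] by auto
    then have uG: "u \<in> G" using True by fastforce
    have surj: "\<exists>h\<in>G. g = h * s" if "g \<in> G" "s \<in> A" "s \<noteq> 0" for g s
    proof -
      define Y where "Y i = (if i = 0 then g else w (i - 1) * s)" for i :: nat
      have wG: "w k \<in> G" if "k \<le> n" for k
        unfolding G_def using that D0 Dr(1)
        by (intro CollectI exI[of _ "\<lambda>j. if j = k then 1 else 0"])
          (auto simp: if_distrib[of "\<lambda>c. c * _"] cong: if_cong)
      have "Y i \<in> G" if "i < Suc (Suc n)" for i
        using that \<open>g \<in> G\<close> wG[of "i - 1"] AR \<open>s \<in> A\<close> by (auto simp: Y_def R_def)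
      then have "\<forall>i. \<exists>c. i < Suc (Suc n) \<longrightarrow> (\<forall>k\<le>n. c k \<in> D) \<and> Y i = (\<Sum>k\<le>n. c k * w k)"
        unfolding G_def by blast
      then obtain c where c: "\<And>i k. i < Suc (Suc n) \<Longrightarrow> k \<le> n \<Longrightarrow> c i k \<in> D"
        "\<And>i. i < Suc (Suc n) \<Longrightarrow> Y i = (\<Sum>k\<le>n. c i k * w k)" by metis
      obtain l where l: "\<forall>i<Suc (Suc n). l i \<in> D" "\<exists>i<Suc (Suc n). l i \<noteq> 0"
        "\<forall>r<Suc n. (\<Sum>i<Suc (Suc n). l i * c i r) = 0"
        using homogeneous_system[of D "Suc (Suc n)" "Suc n" c] Da Dr Dm D0 c(1) by auto
      have "(\<Sum>i<Suc (Suc n). l i * Y i) = (\<Sum>i<Suc (Suc n). \<Sum>k\<le>n. l i * c i k * w k)"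
        using c(2) by (intro sum.cong) (auto simp: sum_distrib_left mult.assoc)
      also have "\<dots> = (\<Sum>k\<le>n. (\<Sum>i<Suc (Suc n). l i * c i k) * w k)"
        unfolding sum_distrib_right by (rule sum.swap)
      also have "\<dots> = 0" using l(3) by (intro sum.neutral) (auto simp del: sum.lessThan_Suc)
      finally have "(\<Sum>i<Suc (Suc n). l i * Y i) = 0" .
      moreover have "(\<Sum>i<Suc (Suc n). l i * Y i) = l 0 * g + (\<Sum>k<Suc n. l (Suc k) * (w k * s))"
        unfolding sum.lessThan_Suc_shift[of _ "Suc n"] by (simp add: Y_def)
      moreover have "(\<Sum>k<Suc n. l (Suc k) * (w k * s)) = (\<Sum>k\<le>n. l (Suc k) * w k) * s"
        by (simp add: sum_distrib_right lessThan_Suc_atMost mult.assoc del: sum.lessThan_Suc)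
      ultimately have rel: "l 0 * g + (\<Sum>k\<le>n. l (Suc k) * w k) * s = 0" by simp
      have l0: "l 0 \<noteq> 0"
      proof
        assume "l 0 = 0"
        then have "(\<Sum>k\<le>n. l (Suc k) * w k) = 0" using rel \<open>s \<noteq> 0\<close> by simp
        then have "\<forall>k\<le>n. l (Suc k) = 0" 
          using l(1) by (intro ind) (auto simp: w_def)
        then have "l i = 0" if "i < Suc (Suc n)" for i using that \<open>l 0 = 0\<close> by (cases i) auto
        then show False using l(2) by blast
      qed
      have "l 0 * g = - (\<Sum>k\<le>n. l (Suc k) * w k) * s" using rel by (simp add: eq_neg_iff_add_eq_0)
      then have "inverse (l 0) * (l 0 * g) = inverse (l 0) * (- (\<Sum>k\<le>n. l (Suc k) * w k) * s)" by simp
      then have "g = (inverse (l 0) * - (\<Sum>k\<le>n. l (Suc k) * w k)) * s" using l0 by (simp add: mult.assoc[symmetric])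
      moreover have "(\<Sum>k\<le>n. l (Suc k) * w k) \<in> G" unfolding G_def using l(1) by (intro CollectI exI) auto
      then have "(- inverse (l 0)) * (\<Sum>k\<le>n. l (Suc k) * w k) \<in> G" using l(1) Dr(3) Dm by (intro Gmul) auto
      ultimately show ?thesis
        by (intro bexI[of _ "(- inverse (l 0)) * (\<Sum>k\<le>n. l (Suc k) * w k)"]) simp_all
    qed
    have all: "y \<in> G" for y
    proof -
      obtain a s where as: "a \<in> A" "s \<in> A" "s \<noteq> 0" "inverse u * y = a * inverse s"
        using quot unfolding is_quotient_ring_def by blast
      have "u * a \<in> G" using uG as(1) AR by (auto simp: R_def)
      then obtain h where h: "h \<in> G" "u * a = h * s" using surj as by blast
      have "y = u * (inverse u * y)" using u by (simp add: mult.assoc[symmetric])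
      also have "\<dots> = h * s * inverse s" unfolding as(4) using h(2) by (simp add: mult.assoc[symmetric])
      also have "\<dots> = h" using as(3) by (simp add: mult.assoc)
      finally show ?thesis using h(1) by simp
    qed
    have "left_findim D"
      unfolding left_findim_def
    proof (intro exI[of _ "w ` {..n}"] conjI allI)
      fix y
      obtain d where d: "\<forall>k\<le>n. d k \<in> D" "y = (\<Sum>k\<le>n. d k * w k)" using all[of y] unfolding G_def by blast
      define c where "c f = (\<Sum>k\<in>{k\<in>{..n}. w k = f}. d k)" for f
      have "y = (\<Sum>f\<in>w ` {..n}. \<Sum>k\<in>{k\<in>{..n}. w k = f}. d k * w k)"
        unfolding d(2) by (rule sum.image_gen) simp
      also have "\<dots> = (\<Sum>f\<in>w ` {..n}. c f * f)"
        unfolding c_def sum_distrib_right by (intro sum.cong) auto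
      finally show "\<exists>c. (\<forall>f\<in>w ` {..n}. c f \<in> D) \<and> y = (\<Sum>f\<in>w ` {..n}. c f * f)"
        using d(1) by (intro exI[of _ c]) (auto simp: c_def intro!: vs.subspace_sum[OF Ds])
    qed simp
    then show ?thesis using nf by blast
  qed
qed

end

section \<open>From the two dimension hypotheses to a forbidden filtration\<close>

theorem theorem1p3:
  fixes emb :: "'k::field \<Rightarrow> 'q::division_ring"
    and A D :: "'q set"
  assumes "central_emb emb"
    and "fg_subalg emb A"
    and "gkdim_fg emb A < 3"
    and "is_quotient_ring A"
    and "div_subalg emb D"
    and "gkdim emb D \<ge> 2"
  shows "left_findim D"
proof (rule ccontr)
  assume nf: "\<not> left_findim D"
  interpret central_algebra emb by unfold_locales (rule assms(1))
  obtain V F where V: "gkdim_fg emb A = growth emb V" "finite F" "V = kspan emb F" "1 \<in> V" "alg_gen emb V = A"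
    using fg_subalg_generating_space[OF assms(2)] by metis
  have dim1: "kdim emb (spow emb V n) \<ge> 1" for n
    using spow_finite_span[OF V(2), of V n] spow_one spow_mono[OF V(4), of 0 n] V(3)
    by (intro kdim_ge_1) auto
  interpret filtered_quotient emb V F
    using V assms(3,4) growth_less_3[OF _ dim1] by unfold_locales auto
  \<comment> \<open>Only an exponent above 1 has to be passed on: the supremum then yields a
    finitely generated subalgebra of \<open>D\<close> of superlinear growth.\<close>
  have "1 < gkdim emb D" using assms(6) by (rule less_le_trans[rotated]) (simp add: one_ereal_def numeral_eq_ereal)
  then obtain C where C: "fg_subalg emb C" "C \<subseteq> D" "1 < gkdim_fg emb C"
    unfolding gkdim_def by (auto simp: less_SUP_iff)
  obtain W E where W: "gkdim_fg emb C = growth emb W" "finite E" "W = kspan emb E" "1 \<in> W" "alg_gen emb W = C"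
    using fg_subalg_generating_space[OF C(1)] by metis
  define q where "q = card E"
  obtain x where x: "bij_betw x {..<q} E" using ex_bij_betw_nat_finite[OF W(2)] by (auto simp: q_def atLeast0LessThan)
  interpret word_algebra emb x q by unfold_locales
  have xD: "x z \<in> D" if "z < q" for z
  proof -
    have "x z \<in> E" using x that by (auto simp: bij_betw_def)
    also have "E \<subseteq> W" unfolding W(3) kspan_eq by (rule vs.span_superset)
    finally show ?thesis using alg_gen_base[of W] W(5) C(2) by blast
  qed
  \<comment> \<open>If one \<open>c\<close> bounded all independent families of words, the powers of
    \<open>W\<close> would have dimension at most \<open>c * (n + 1)\<close>, and the growth of
    \<open>W\<close> would be at most 1.\<close>
  have growth: "\<exists>n T. finite T \<and> (\<forall>w\<in>T. set w \<subseteq> {..<q} \<and> length w \<le> n) \<and> c * (n + 1) < card T \<and> kindep emb T ev" for c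
  proof (rule ccontr)
    assume no: "\<not> ?thesis"
    have "kdim emb (spow emb W n) \<le> c * (n + 1)" for n
    proof -
      have sp: "spow emb W n \<subseteq> kspan emb (ev ` words n)"
      proof -
        have "{prod_list xs | xs. length xs = n \<and> set xs \<subseteq> E} \<subseteq> ev ` words n"
        proof
          fix v assume "v \<in> {prod_list xs | xs. length xs = n \<and> set xs \<subseteq> E}"
          then obtain xs where xs: "length xs = n" "set xs \<subseteq> E" "v = prod_list xs" by blast
          define w where "w = map (the_inv_into {..<q} x) xs"
          have "x (the_inv_into {..<q} x y) = y" "the_inv_into {..<q} x y < q" if "y \<in> E" for y
            using x that f_the_inv_into_f_bij_betw[OF x] bij_betw_the_inv_into[OF x] by (auto simp: bij_betw_def)
          then have "map x w = xs" "w \<in> words n" using xs by (auto simp: w_def words_def intro!: map_idI)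
          then show "v \<in> ev ` words n" using xs(3) by (metis ev_def image_eqI)
        qed
        then have "kspan emb {prod_list xs | xs. length xs = n \<and> set xs \<subseteq> E} \<subseteq> kspan emb (ev ` words n)"
          unfolding kspan_eq by (rule vs.span_mono)
        then show ?thesis using spow_finite_span(1)[OF W(2), of W n] W(3) by blast
      qed
      obtain B where B: "B \<subseteq> ev ` words n" "vs.independent B" "ev ` words n \<subseteq> vs.span B"
        using vs.maximal_independent_subset by blast
      \<comment> \<open>One word is chosen over each basis element, so that independence of the
        basis becomes independence of the family \<open>ev\<close> on \<open>T\<close>.\<close>
      obtain T where T: "T \<subseteq> words n" "inj_on ev T" "B = ev ` T" using B(1) by (auto simp: subset_image_inj)
      have fT: "finite T" by (rule finite_subset[OF T(1) finite_words])
      have "kindep emb T ev"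
        unfolding kindep_def
      proof (intro allI impI ballI)
        fix l w assume l: "(\<Sum>w\<in>T. emb (l w) * ev w) = 0" "w \<in> T"
        have "(\<Sum>y\<in>B. emb (l (the_inv_into T ev y)) * y) = (\<Sum>w\<in>T. emb (l w) * ev w)"
          unfolding T(3) sum.reindex[OF T(2)] using T(2) by (intro sum.cong) (auto simp: the_inv_into_f_f)
        then have z: "(\<Sum>y\<in>B. emb (l (the_inv_into T ev y)) * y) = 0" using l(1) by simp
        have ki: "kindep emb B (\<lambda>y. y)" using kindep_independent[OF _ B(2)] fT T(3) by simp
        have "ev w \<in> B" using l(2) T(3) by blast
        then have "l (the_inv_into T ev (ev w)) = 0" by (rule ki[unfolded kindep_def, rule_format, OF z])
        then show "l w = 0" using l(2) T(2) by (simp add: the_inv_into_f_f)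
      qed
      moreover have "\<forall>w\<in>T. set w \<subseteq> {..<q} \<and> length w \<le> n" using T(1) by (auto simp: words_def)
      ultimately have "\<not> c * (n + 1) < card T" using no fT by blast
      moreover have "spow emb W n \<subseteq> vs.span B"
        using sp vs.span_minimal[OF B(3) vs.subspace_span] by (auto simp: kspan_eq)
      then have "kdim emb (spow emb W n) \<le> card B" unfolding kdim_eq using fT T(3) by (intro vs.dim_le_card) auto
      ultimately show ?thesis unfolding T(3) card_image[OF T(2)] by linarith
    qed
    then have "growth emb W \<le> 1" by (rule growth_le_1)
    then show False using C(3) W(1) by simp
  qed
  obtain s where s: "s \<in> alg_gen emb V" "s \<noteq> 0" "\<forall>z<q. s * x z \<in> alg_gen emb V" using common_left_denominator by blast
  obtain r where r: "r \<in> alg_gen emb V" "r \<noteq> 0" "\<forall>z<q. x z * r \<in> alg_gen emb V" using common_right_denominator by blast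
  obtain p1 p2 p3 p4 where p: "s \<in> spow emb V p1" "r \<in> spow emb V p2"
    "\<forall>z<q. s * x z \<in> spow emb V p3" "\<forall>z<q. x z * r \<in> spow emb V p4"
    using A_mem_U[OF s(1)] A_mem_U[OF r(1)] finite_mem_U[of q "\<lambda>z. s * x z"] finite_mem_U[of q "\<lambda>z. x z * r"] s r
    by metis
  \<comment> \<open>A sum serves as a common upper bound for the four filtration degrees.\<close>
  define P where "P = p1 + p2 + p3 + p4"
  have sub: "spow emb V p1 \<subseteq> spow emb V P" "spow emb V p2 \<subseteq> spow emb V P"
    "spow emb V p3 \<subseteq> spow emb V P" "spow emb V p4 \<subseteq> spow emb V P"
    by (intro spow_mono[OF V(4)]; simp add: P_def)+
  show False
  proof (rule no_slow_filtration[of "spow emb V" D s P r])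
    show "ksubalg emb D" using assms(5) by (simp add: div_subalg_def)
  qed (use growth xD sub p s r spow_subspace U_finite spow_one spow_Suc_mono[OF V(4)] spow_mult small
      left_independent_exists[OF assms(5) nf] in \<open>auto simp: subset_iff\<close>)
qed

end
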